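(* Let $\mathscr{R}$ be a finite von Neumann algebra with a faithful normal tracial state $\tau$, let $\mathscr{S}$ be a von Neumann subalgebra of $\mathscr{R}$, and let $\Phi:\mathscr{R}\to\mathscr{S}$ be a $\tau$-preserving conditional expectation from $\mathscr{R}$ onto $\mathscr{S}$. Let $\Delta$ denote the Fuglede-Kadison determinant on $\mathscr{R}$ associated with $\tau$. For a regular positive operator $A$ in $\mathscr{R}$ and a positive operator $B$ in $\mathscr{S}$, $$\frac{\Delta(\Phi(A)+B)}{\Delta(\Phi(A))}\le\frac{\Delta(A+B)}{\Delta(A)}.$$ If $B$ is regular, equality holds if and only if $\Phi(A)=A$, i.e. $A\in\mathscr{S}$.
   Context: Von Neumann algebras act on a separable complex Hilbert space and contain the identity operator $I$; $\mathscr{S}$ contains the identity $I$ of $\mathscr{R}$. "Regular" means invertible (with bounded inverse). Conditional expectation: a map $\Phi:\mathscr{R}\to\mathscr{S}$ that is linear, positive, with $\Phi(I)=I$, and $\Phi(S_1RS_2)=S_1\Phi(R)S_2$ for all $R\in\mathscr{R}$, $S_1,S_2\in\mathscr{S}$. It is $\tau$-preserving if $\tau(\Phi(R))=\tau(R)$ for all $R\in\mathscr{R}$. Fuglede-Kadison determinant: for regular $A\in\mathscr{R}$, $\Delta(A)=\exp(\tau(\log (A^*A)^{1/2}))$ (all operators to which $\Delta$ is applied in the claim are regular). *)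

theory Defs
  imports "HOL-Analysis.Analysis" "HOL-Computational_Algebra.Polynomial"
begin

section \<open>Separable complex Hilbert spaces\<close>

text \<open>
  The real inner product underlying \<^class>\<open>real_inner\<close> is the real part of \<open>cinner\<close>, so norm and
  topology are those of the complex inner product, which is linear in the first argument. For a
  metric space, second countability (part of \<^class>\<open>polish_space\<close>) is separability.
\<close>

class separable_hilbert_space = real_inner + polish_space +
  fixes scaleC :: "complex \<Rightarrow> 'a \<Rightarrow> 'a"  (infixr \<open>*\<^sub>C\<close> 75)
    and cinner :: "'a \<Rightarrow> 'a \<Rightarrow> complex"
  assumes scaleC_add_right: "c *\<^sub>C (x + y) = c *\<^sub>C x + c *\<^sub>C y"
    and scaleC_add_left: "(c + d) *\<^sub>C x = c *\<^sub>C x + d *\<^sub>C x"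
    and scaleC_scaleC: "c *\<^sub>C (d *\<^sub>C x) = (c * d) *\<^sub>C x"
    and scaleC_of_real: "complex_of_real r *\<^sub>C x = r *\<^sub>R x"
    and cinner_commute: "cinner x y = cnj (cinner y x)"
    and cinner_add_left: "cinner (x + y) z = cinner x z + cinner y z"
    and cinner_scaleC_left: "cinner (c *\<^sub>C x) y = c * cinner x y"
    and Re_cinner: "Re (cinner x y) = x \<bullet> y"

instantiation complex :: separable_hilbert_space
begin
definition scaleC_complex :: "complex \<Rightarrow> complex \<Rightarrow> complex"
  where "scaleC_complex c x = c * x"
definition cinner_complex :: "complex \<Rightarrow> complex \<Rightarrow> complex"
  where "cinner_complex x y = x * cnj y"
instance
  by standard
    (auto simp: scaleC_complex_def cinner_complex_def inner_complex_def scaleR_conv_of_real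
      algebra_simps)
end

lemma norm_scaleC: "norm (c *\<^sub>C x) = cmod c * norm (x :: 'a::separable_hilbert_space)"
proof -
  have "cinner x x = cnj (cinner x x)"
    by (rule cinner_commute)
  then have im: "Im (cinner x x) = 0"
    by (simp add: complex_eq_iff)
  have "cinner (c *\<^sub>C x) (c *\<^sub>C x) = c * cnj (c * cinner x x)"
    by (metis cinner_commute cinner_scaleC_left)
  then have "(c *\<^sub>C x) \<bullet> (c *\<^sub>C x) = (cmod c)\<^sup>2 * (x \<bullet> x)"
    using im
    by (simp add: Re_cinner[symmetric] cmod_power2) (simp add: power2_eq_square algebra_simps)
  then have "(norm (c *\<^sub>C x))\<^sup>2 = (cmod c * norm x)\<^sup>2"
    by (simp add: power2_norm_eq_inner power_mult_distrib)
  then show ?thesis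
    by (simp add: power2_eq_iff_nonneg)
qed

section \<open>Bounded operators\<close>

text \<open>
  Elements of \<^typ>\<open>'a \<Rightarrow>\<^sub>L 'a\<close> are bounded and real-linear. The operators of the theory are the
  complex-linear ones.
\<close>

definition bounded_operators :: "('a::separable_hilbert_space \<Rightarrow>\<^sub>L 'a) set"
  where "bounded_operators = {T. \<forall>c x. blinfun_apply T (c *\<^sub>C x) = c *\<^sub>C blinfun_apply T x}"

lift_definition op_scaleC ::
  "complex \<Rightarrow> ('a::separable_hilbert_space \<Rightarrow>\<^sub>L 'a) \<Rightarrow> 'a \<Rightarrow>\<^sub>L 'a"
  is "\<lambda>c T x. c *\<^sub>C T x"
proof -
  fix c :: complex and T :: "'a \<Rightarrow> 'a"
  assume T: "bounded_linear T"
  have "bounded_linear (\<lambda>x::'a. c *\<^sub>C x)"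
  proof (rule bounded_linear_intro[where K = "cmod c"])
    show "c *\<^sub>C (r *\<^sub>R x) = r *\<^sub>R (c *\<^sub>C x)" for r and x :: 'a
      by (metis mult.commute scaleC_of_real scaleC_scaleC)
  qed (simp_all add: scaleC_add_right norm_scaleC mult.commute)
  then show "bounded_linear (\<lambda>x. c *\<^sub>C T x)"
    using T by (rule bounded_linear_compose)
qed

text \<open>The adjoint exists (Riesz) for complex-linear operators, and is only used for those.\<close>

definition op_adjoint :: "('a::separable_hilbert_space \<Rightarrow>\<^sub>L 'a) \<Rightarrow> 'a \<Rightarrow>\<^sub>L 'a"
  where "op_adjoint T = (THE S. \<forall>x y. cinner (T x) y = cinner x (blinfun_apply S y))"

definition self_adjoint_op :: "('a::separable_hilbert_space \<Rightarrow>\<^sub>L 'a) \<Rightarrow> bool"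
  where "self_adjoint_op T \<longleftrightarrow> T \<in> bounded_operators \<and> op_adjoint T = T"

definition positive_op :: "('a::separable_hilbert_space \<Rightarrow>\<^sub>L 'a) \<Rightarrow> bool"
  where "positive_op T \<longleftrightarrow> T \<in> bounded_operators \<and> (\<forall>x. cinner (T x) x \<in> \<real>\<^sub>\<ge>\<^sub>0)"

definition op_le :: "('a::separable_hilbert_space \<Rightarrow>\<^sub>L 'a) \<Rightarrow> ('a \<Rightarrow>\<^sub>L 'a) \<Rightarrow> bool"
  where "op_le S T \<longleftrightarrow> positive_op (T - S)"

definition regular_op :: "('a::separable_hilbert_space \<Rightarrow>\<^sub>L 'a) \<Rightarrow> bool"
  where "regular_op T \<longleftrightarrow> T \<in> bounded_operators \<and>
    (\<exists>S\<in>bounded_operators. S o\<^sub>L T = id_blinfun \<and> T o\<^sub>L S = id_blinfun)"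

definition op_spectrum :: "('a::separable_hilbert_space \<Rightarrow>\<^sub>L 'a) \<Rightarrow> complex set"
  where "op_spectrum T = {z. \<not> regular_op (op_scaleC z id_blinfun - T)}"

section \<open>Continuous functional calculus for self-adjoint operators\<close>

definition op_poly :: "real poly \<Rightarrow> ('a::separable_hilbert_space \<Rightarrow>\<^sub>L 'a) \<Rightarrow> 'a \<Rightarrow>\<^sub>L 'a"
  where "op_poly p T = (\<Sum>i\<le>degree p. coeff p i *\<^sub>R ((o\<^sub>L) T ^^ i) id_blinfun)"

text \<open>
  For self-adjoint \<open>T\<close> (whose spectrum is real) and \<open>f\<close> continuous on the spectrum, \<open>f(T)\<close> is the
  norm limit of \<open>p n (T)\<close> for every sequence of polynomials \<open>p n\<close> tending to \<open>f\<close> uniformly on the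
  spectrum.
\<close>

definition functional_calculus ::
  "(real \<Rightarrow> real) \<Rightarrow> ('a::separable_hilbert_space \<Rightarrow>\<^sub>L 'a) \<Rightarrow> 'a \<Rightarrow>\<^sub>L 'a"
  where "functional_calculus f T = (THE S. \<forall>p :: nat \<Rightarrow> real poly.
    uniform_limit {t. complex_of_real t \<in> op_spectrum T} (\<lambda>n t. poly (p n) t) f sequentially
      \<longrightarrow> (\<lambda>n. op_poly (p n) T) \<longlonglongrightarrow> S)"

definition op_abs :: "('a::separable_hilbert_space \<Rightarrow>\<^sub>L 'a) \<Rightarrow> 'a \<Rightarrow>\<^sub>L 'a"
  where "op_abs T = functional_calculus sqrt (op_adjoint T o\<^sub>L T)"

definition op_log :: "('a::separable_hilbert_space \<Rightarrow>\<^sub>L 'a) \<Rightarrow> 'a \<Rightarrow>\<^sub>L 'a"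
  where "op_log T = functional_calculus ln T"

section \<open>Von Neumann algebras\<close>

text \<open>
  The coarsest topology making all maps \<open>T \<mapsto> cinner (T x) y\<close> continuous; compare
  \<^const>\<open>strong_operator_topology\<close>.
\<close>

definition weak_operator_topology :: "('a::separable_hilbert_space \<Rightarrow>\<^sub>L 'a) topology"
  where "weak_operator_topology =
    pullback_topology UNIV (\<lambda>T (x, y). cinner (blinfun_apply T x) y) euclidean"

definition von_neumann_algebra :: "('a::separable_hilbert_space \<Rightarrow>\<^sub>L 'a) set \<Rightarrow> bool"
  where "von_neumann_algebra R \<longleftrightarrow>
    R \<subseteq> bounded_operators \<and> id_blinfun \<in> R \<and>
    (\<forall>S\<in>R. \<forall>T\<in>R. S + T \<in> R) \<and>
    (\<forall>c. \<forall>T\<in>R. op_scaleC c T \<in> R) \<and>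
    (\<forall>S\<in>R. \<forall>T\<in>R. S o\<^sub>L T \<in> R) \<and>
    (\<forall>T\<in>R. op_adjoint T \<in> R) \<and>
    closedin weak_operator_topology R"

text \<open>
  Finiteness: the identity is a finite projection of \<open>R\<close>, that is, if a partial isometry \<open>V\<close> in \<open>R\<close>
  has initial projection \<open>I\<close> then its final projection is \<open>I\<close>.
\<close>

definition finite_von_neumann_algebra :: "('a::separable_hilbert_space \<Rightarrow>\<^sub>L 'a) set \<Rightarrow> bool"
  where "finite_von_neumann_algebra R \<longleftrightarrow> von_neumann_algebra R \<and>
    (\<forall>V\<in>R. op_adjoint V o\<^sub>L V = id_blinfun \<longrightarrow> V o\<^sub>L op_adjoint V = id_blinfun)"

definition state_on ::
  "('a::separable_hilbert_space \<Rightarrow>\<^sub>L 'a) set \<Rightarrow> (('a \<Rightarrow>\<^sub>L 'a) \<Rightarrow> complex) \<Rightarrow> bool"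
  where "state_on R \<tau> \<longleftrightarrow>
    (\<forall>S\<in>R. \<forall>T\<in>R. \<tau> (S + T) = \<tau> S + \<tau> T) \<and>
    (\<forall>c. \<forall>T\<in>R. \<tau> (op_scaleC c T) = c * \<tau> T) \<and>
    (\<forall>T\<in>R. positive_op T \<longrightarrow> \<tau> T \<in> \<real>\<^sub>\<ge>\<^sub>0) \<and>
    \<tau> id_blinfun = 1"

definition tracial_on ::
  "('a::separable_hilbert_space \<Rightarrow>\<^sub>L 'a) set \<Rightarrow> (('a \<Rightarrow>\<^sub>L 'a) \<Rightarrow> complex) \<Rightarrow> bool"
  where "tracial_on R \<tau> \<longleftrightarrow> (\<forall>S\<in>R. \<forall>T\<in>R. \<tau> (S o\<^sub>L T) = \<tau> (T o\<^sub>L S))"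

definition faithful_on ::
  "('a::separable_hilbert_space \<Rightarrow>\<^sub>L 'a) set \<Rightarrow> (('a \<Rightarrow>\<^sub>L 'a) \<Rightarrow> complex) \<Rightarrow> bool"
  where "faithful_on R \<tau> \<longleftrightarrow> (\<forall>T\<in>R. positive_op T \<and> \<tau> T = 0 \<longrightarrow> T = 0)"

definition directed_ops :: "('a::separable_hilbert_space \<Rightarrow>\<^sub>L 'a) set \<Rightarrow> bool"
  where "directed_ops D \<longleftrightarrow> D \<noteq> {} \<and> (\<forall>S\<in>D. \<forall>T\<in>D. \<exists>U\<in>D. op_le S U \<and> op_le T U)"

definition is_op_lub ::
  "('a::separable_hilbert_space \<Rightarrow>\<^sub>L 'a) set \<Rightarrow> ('a \<Rightarrow>\<^sub>L 'a) set \<Rightarrow> ('a \<Rightarrow>\<^sub>L 'a) \<Rightarrow> bool"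
  where "is_op_lub R D H \<longleftrightarrow> H \<in> R \<and> self_adjoint_op H \<and> (\<forall>T\<in>D. op_le T H) \<and>
    (\<forall>K\<in>R. self_adjoint_op K \<and> (\<forall>T\<in>D. op_le T K) \<longrightarrow> op_le H K)"

text \<open>
  Normality of a positive functional: \<open>\<tau>\<close> preserves least upper bounds of increasing nets. Nets are
  rendered as upward directed sets of self-adjoint operators; by monotonicity convergence of \<open>\<tau>\<close>
  along the net is convergence to the supremum.
\<close>

definition normal_on ::
  "('a::separable_hilbert_space \<Rightarrow>\<^sub>L 'a) set \<Rightarrow> (('a \<Rightarrow>\<^sub>L 'a) \<Rightarrow> complex) \<Rightarrow> bool"
  where "normal_on R \<tau> \<longleftrightarrow>
    (\<forall>D H. D \<subseteq> {T\<in>R. self_adjoint_op T} \<and> directed_ops D \<and> is_op_lub R D H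
      \<longrightarrow> Re (\<tau> H) = (SUP T\<in>D. Re (\<tau> T)))"

definition conditional_expectation ::
  "('a::separable_hilbert_space \<Rightarrow>\<^sub>L 'a) set \<Rightarrow> ('a \<Rightarrow>\<^sub>L 'a) set
    \<Rightarrow> (('a \<Rightarrow>\<^sub>L 'a) \<Rightarrow> 'a \<Rightarrow>\<^sub>L 'a) \<Rightarrow> bool"
  where "conditional_expectation R S \<Phi> \<longleftrightarrow>
    \<Phi> \<in> R \<rightarrow> S \<and>
    (\<forall>T\<in>R. \<forall>U\<in>R. \<Phi> (T + U) = \<Phi> T + \<Phi> U) \<and>
    (\<forall>c. \<forall>T\<in>R. \<Phi> (op_scaleC c T) = op_scaleC c (\<Phi> T)) \<and>
    (\<forall>T\<in>R. positive_op T \<longrightarrow> positive_op (\<Phi> T)) \<and>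
    \<Phi> id_blinfun = id_blinfun \<and>
    (\<forall>T\<in>R. \<forall>S\<^sub>1\<in>S. \<forall>S\<^sub>2\<in>S. \<Phi> (S\<^sub>1 o\<^sub>L T o\<^sub>L S\<^sub>2) = S\<^sub>1 o\<^sub>L \<Phi> T o\<^sub>L S\<^sub>2)"

text \<open>
  The Fuglede-Kadison determinant of a regular operator; \<open>\<tau>\<close> takes a real value at the self-adjoint
  operator \<open>log |T|\<close>.
\<close>

definition fuglede_kadison_det ::
  "(('a::separable_hilbert_space \<Rightarrow>\<^sub>L 'a) \<Rightarrow> complex) \<Rightarrow> ('a \<Rightarrow>\<^sub>L 'a) \<Rightarrow> real"
  where "fuglede_kadison_det \<tau> T = exp (Re (\<tau> (op_log (op_abs T))))"

end

theory Submission
  imports Defs "HOL-Computational_Algebra.Fundamental_Theorem_Algebra"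
begin

text \<open>
  The trace satisfies \<open>d/ds \<tau> (log (A + s B)) = \<tau> ((A + s B)\<^sup>-\<^sup>1 B)\<close>. Put \<open>X = A + s B\<close>,
  \<open>Y = \<Phi> X = \<Phi> A + s B\<close> and \<open>D = X - Y = A - \<Phi> A\<close>. Since
  \<open>\<Phi> (D X\<^sup>-\<^sup>1 D) = Y (\<Phi> (X\<^sup>-\<^sup>1) - Y\<^sup>-\<^sup>1) Y\<close>, the operator \<open>\<Phi> (X\<^sup>-\<^sup>1) - Y\<^sup>-\<^sup>1\<close> is positive, hence
  \<open>\<tau> (X\<^sup>-\<^sup>1 B) - \<tau> (Y\<^sup>-\<^sup>1 B) = \<tau> ((\<Phi> (X\<^sup>-\<^sup>1) - Y\<^sup>-\<^sup>1) B) \<ge> 0\<close>. Integrating over \<open>0 \<le> s \<le> 1\<close> gives the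
  inequality. If \<open>B \<ge> b > 0\<close>, the same computation bounds the integrand below by a positive
  multiple of \<open>\<tau> (D\<^sup>2)\<close>, so equality forces \<open>D = 0\<close> by faithfulness.
\<close>

text \<open>\<open>op_log\<close> is only a norm limit of polynomials, and \<open>A\<close> and
  \<open>B\<close> need not commute, so the operator logarithm itself is never differentiated. A
  polynomial \<open>p\<close> that is close to \<open>ln\<close> and whose derivative is close to
  \<open>inverse\<close> stands in for it; for polynomials the derivative formula under the trace is
  algebra. One \<open>p\<close> serves all operators along both paths because their spectra lie in a
  common interval \<open>{a..M}\<close>: the lower bound \<open>a\<close> of \<open>A\<close>
  survives the expectation, and \<open>M\<close> dominates all norms. That errors on this interval
  control operator norms is proved without a spectral theorem, from the invertibility of
  \<open>p(T)\<close> for polynomials with no zero on the spectrum. The lower bound on the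
  derivative does not depend on \<open>s\<close>, so the mean value theorem takes the place of an
  integral. Both claims come from one estimate with a parameter \<open>b\<close>, taken as
  \<open>0\<close> for the inequality and positive for the equality case.\<close>

instance separable_hilbert_space \<subseteq> banach ..

section \<open>Symmetric operators\<close>

text \<open>Self-adjointness through the real inner product, which keeps the definite description in
  \<open>op_adjoint\<close> out of the estimates. For complex-linear operators real and complex
  symmetry agree.\<close>

definition symmetric_op :: "('a::separable_hilbert_space \<Rightarrow>\<^sub>L 'a) \<Rightarrow> bool"
  where "symmetric_op T \<longleftrightarrow> T \<in> bounded_operators \<and> (\<forall>x y. T x \<bullet> y = x \<bullet> T y)"

lemma symmetric_op_bounded: "symmetric_op T \<Longrightarrow> T \<in> bounded_operators"
  by (simp add: symmetric_op_def)

lemma symmetric_opD: "symmetric_op T \<Longrightarrow> T x \<bullet> y = x \<bullet> T y"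
  by (simp add: symmetric_op_def)

lemma op_scaleC_of_real: "op_scaleC (complex_of_real r) T = r *\<^sub>R T"
  by (rule blinfun_eqI) (simp add: op_scaleC.rep_eq scaleC_of_real scaleR_blinfun.rep_eq)

lemma scaleC_zero_right [simp]: "c *\<^sub>C (0 :: 'a::separable_hilbert_space) = 0"
  by (metis add_cancel_right_right scaleC_add_right)

lemma scaleC_minus_right: "c *\<^sub>C (- x) = - (c *\<^sub>C (x :: 'a::separable_hilbert_space))"
  by (metis add.right_inverse add_eq_0_iff scaleC_add_right scaleC_zero_right)

lemma scaleC_diff_right: "c *\<^sub>C (x - y) = c *\<^sub>C x - c *\<^sub>C (y :: 'a::separable_hilbert_space)"
  by (metis add_uminus_conv_diff scaleC_add_right scaleC_minus_right)

lemma scaleC_scaleR: "c *\<^sub>C (r *\<^sub>R x) = r *\<^sub>R (c *\<^sub>C (x :: 'a::separable_hilbert_space))"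
  by (metis mult.commute scaleC_of_real scaleC_scaleC)

lemma bounded_linear_scaleC: "bounded_linear ((*\<^sub>C) c :: 'a::separable_hilbert_space \<Rightarrow> 'a)"
  by (rule bounded_linear_intro[where K = "cmod c"])
    (simp_all add: scaleC_add_right scaleC_scaleR norm_scaleC mult.commute)

lemma bounded_operators_scaleC: "T \<in> bounded_operators \<Longrightarrow> T (c *\<^sub>C x) = c *\<^sub>C T x"
  by (simp add: bounded_operators_def)

text \<open>Multiplying by \<open>-\<i>\<close> moves the imaginary part into the real part, so
  every complex statement reduces to the real inner product.\<close>

lemma cinner_conv_inner:
  "cinner x y = Complex (x \<bullet> y) (((- \<i>) *\<^sub>C x) \<bullet> (y :: 'a::separable_hilbert_space))"
  by (simp add: complex_eq_iff Re_cinner[symmetric] cinner_scaleC_left)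

lemma cinner_symmetric_op: "symmetric_op T \<Longrightarrow> cinner (T x) y = cinner x (T y)"
  unfolding cinner_conv_inner
  by (metis bounded_operators_scaleC symmetric_op_def)

lemma cinner_eqI:
  assumes "\<And>x. cinner x y = cinner x (z :: 'a::separable_hilbert_space)"
  shows "y = z"
proof -
  have "(y - z) \<bullet> y = (y - z) \<bullet> z"
    by (metis Re_cinner assms)
  then have "(y - z) \<bullet> (y - z) = 0"
    by (simp add: inner_diff_right)
  then show ?thesis by simp
qed

text \<open>Symmetry exhibits \<open>T\<close> as an adjoint and nondegeneracy makes it the only
  one. This evaluates the definite description inside \<open>op_abs\<close>.\<close>

lemma op_adjoint_symmetric:
  assumes "symmetric_op T"
  shows "op_adjoint T = T"
  unfolding op_adjoint_def
proof (rule the_equality)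
  show "\<forall>x y. cinner (T x) y = cinner x (T y)"
    using assms by (simp add: cinner_symmetric_op)
next
  fix S assume S: "\<forall>x y. cinner (T x) y = cinner x (blinfun_apply S y)"
  show "S = T"
  proof (rule blinfun_eqI)
    fix y show "S y = T y"
      by (rule cinner_eqI) (metis S assms cinner_symmetric_op)
  qed
qed

text \<open>Real values of the complex quadratic form mean that
  \<open>(\<i> *\<^sub>C T x) \<bullet> x\<close> vanishes for all \<open>x\<close>. By polarization
  \<open>\<i> T\<close> is skew, and complex linearity turns this into symmetry of
  \<open>T\<close>.\<close>

lemma positive_op_iff: "positive_op T \<longleftrightarrow> symmetric_op T \<and> (\<forall>x. T x \<bullet> x \<ge> 0)"
proof
  assume T: "positive_op T"
  then have bo: "T \<in> bounded_operators" and
    p: "\<And>x. Re (cinner (T x) x) \<ge> 0 \<and> Im (cinner (T x) x) = 0"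
    by (auto simp: positive_op_def complex_nonneg_Reals_iff)
  have im: "(\<i> *\<^sub>C T x) \<bullet> x = 0" for x
  proof -
    have "Re (cinner (\<i> *\<^sub>C T x) x) = - Im (cinner (T x) x)"
      by (simp add: cinner_scaleC_left)
    then show ?thesis using p[of x] by (simp add: Re_cinner)
  qed
  have skew: "(\<i> *\<^sub>C x) \<bullet> y = - (x \<bullet> (\<i> *\<^sub>C y))" for x y :: 'a
  proof -
    have "(\<i> *\<^sub>C x) \<bullet> y = - Im (cinner x y)"
      by (simp add: Re_cinner[symmetric] cinner_scaleC_left)
    moreover have "x \<bullet> (\<i> *\<^sub>C y) = (\<i> *\<^sub>C y) \<bullet> x"
      by (rule inner_commute)
    moreover have "(\<i> *\<^sub>C y) \<bullet> x = - Im (cinner y x)"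
      by (simp add: Re_cinner[symmetric] cinner_scaleC_left)
    moreover have "Im (cinner y x) = - Im (cinner x y)"
      using arg_cong[OF cinner_commute[of y x], of Im] by simp
    ultimately show ?thesis by simp
  qed
  have ii: "\<i> *\<^sub>C (\<i> *\<^sub>C x) = - x" for x :: 'a
    using scaleC_of_real[of "-1" x] by (simp add: scaleC_scaleC)
  have sym: "(\<i> *\<^sub>C T x) \<bullet> y = - ((\<i> *\<^sub>C T y) \<bullet> x)" for x y
    using im[of "x + y"] im[of x] im[of y]
    by (simp add: blinfun.add_right scaleC_add_right inner_add_left inner_add_right)
  have "T x \<bullet> y = x \<bullet> T y" for x y
  proof -
    have "T x \<bullet> y = - ((\<i> *\<^sub>C T (\<i> *\<^sub>C x)) \<bullet> y)"
      by (simp add: bounded_operators_scaleC[OF bo] ii)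
    also have "\<dots> = (\<i> *\<^sub>C T y) \<bullet> (\<i> *\<^sub>C x)"
      by (subst sym) simp
    also have "\<dots> = T y \<bullet> x"
      using skew[of "T y" "\<i> *\<^sub>C x"] by (simp add: ii)
    finally show ?thesis by (simp add: inner_commute)
  qed
  with bo p show "symmetric_op T \<and> (\<forall>x. T x \<bullet> x \<ge> 0)"
    by (simp add: symmetric_op_def Re_cinner)
next
  assume T: "symmetric_op T \<and> (\<forall>x. T x \<bullet> x \<ge> 0)"
  have "Im (cinner (T x) x) = 0" for x
  proof -
    have "cinner (T x) x = cnj (cinner (T x) x)"
      using T cinner_symmetric_op cinner_commute by metis
    then show ?thesis by (simp add: complex_eq_iff)
  qed
  with T show "positive_op T"
    by (auto simp: positive_op_def complex_nonneg_Reals_iff Re_cinner symmetric_op_bounded)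
qed

lemma positive_op_symmetric: "positive_op T \<Longrightarrow> symmetric_op T"
  and positive_opD: "positive_op T \<Longrightarrow> T x \<bullet> x \<ge> 0"
  by (simp_all add: positive_op_iff)

lemma bounded_operators_add: "S \<in> bounded_operators \<Longrightarrow> T \<in> bounded_operators \<Longrightarrow> S + T \<in> bounded_operators"
  and bounded_operators_diff: "S \<in> bounded_operators \<Longrightarrow> T \<in> bounded_operators \<Longrightarrow> S - T \<in> bounded_operators"
  and bounded_operators_scaleR: "T \<in> bounded_operators \<Longrightarrow> r *\<^sub>R T \<in> bounded_operators"
  and bounded_operators_compose: "S \<in> bounded_operators \<Longrightarrow> T \<in> bounded_operators \<Longrightarrow> S o\<^sub>L T \<in> bounded_operators"
  and bounded_operators_id: "id_blinfun \<in> bounded_operators"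
  by (auto simp: bounded_operators_def blinfun.bilinear_simps scaleC_add_right scaleC_diff_right
      scaleC_scaleR)

lemma symmetric_op_add: "symmetric_op S \<Longrightarrow> symmetric_op T \<Longrightarrow> symmetric_op (S + T)"
  and symmetric_op_diff: "symmetric_op S \<Longrightarrow> symmetric_op T \<Longrightarrow> symmetric_op (S - T)"
  and symmetric_op_scaleR: "symmetric_op T \<Longrightarrow> symmetric_op (r *\<^sub>R T)"
  and symmetric_op_id: "symmetric_op id_blinfun"
  by (auto simp: symmetric_op_def bounded_operators_add bounded_operators_diff
      bounded_operators_scaleR bounded_operators_id blinfun.bilinear_simps inner_add_left
      inner_add_right inner_diff_left inner_diff_right)

lemma symmetric_op_compose:
  assumes "symmetric_op S" "symmetric_op T" "S o\<^sub>L T = T o\<^sub>L S"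
  shows "symmetric_op (S o\<^sub>L T)"
proof -
  have "(S o\<^sub>L T) x \<bullet> y = x \<bullet> (S o\<^sub>L T) y" for x y
  proof -
    have "(S o\<^sub>L T) x \<bullet> y = x \<bullet> (T o\<^sub>L S) y"
      using assms(1,2) by (simp add: symmetric_opD)
    with assms(3) show ?thesis by simp
  qed
  then show ?thesis
    using assms by (simp add: symmetric_op_def bounded_operators_compose)
qed

lemma symmetric_op_jordan:
  assumes "symmetric_op S" "symmetric_op T"
  shows "symmetric_op ((S o\<^sub>L T) + (T o\<^sub>L S))"
  using assms unfolding symmetric_op_def
  by (simp add: bounded_operators_add bounded_operators_compose blinfun.bilinear_simps
      inner_add_left inner_add_right)

text \<open>Both defining conditions are pointwise equations and pass to limits. A general filter
  covers polynomial sequences as well as difference quotients at \<open>0\<close>.\<close>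

lemma symmetric_op_limit:
  fixes T :: "'a::separable_hilbert_space \<Rightarrow>\<^sub>L 'a"
  assumes "(F \<longlongrightarrow> T) net" "net \<noteq> bot" "eventually (\<lambda>s. symmetric_op (F s)) net"
  shows "symmetric_op T"
proof -
  have lim: "((\<lambda>s. F s x) \<longlongrightarrow> T x) net" for x
    by (rule blinfun.tendsto[OF assms(1) tendsto_const])
  have "T (c *\<^sub>C x) = c *\<^sub>C T x" for c x
  proof (rule tendsto_unique[OF assms(2)])
    show "((\<lambda>s. F s (c *\<^sub>C x)) \<longlongrightarrow> T (c *\<^sub>C x)) net" by (rule lim)
    have "((\<lambda>s. c *\<^sub>C F s x) \<longlongrightarrow> c *\<^sub>C T x) net"
      by (rule bounded_linear.tendsto[OF bounded_linear_scaleC lim])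
    then show "((\<lambda>s. F s (c *\<^sub>C x)) \<longlongrightarrow> c *\<^sub>C T x) net"
      by (rule Lim_transform_eventually)
        (use assms(3) in eventually_elim, simp add: bounded_operators_scaleC symmetric_op_bounded)
  qed
  moreover have "T x \<bullet> y = x \<bullet> T y" for x y
  proof (rule tendsto_unique[OF assms(2)])
    show "((\<lambda>s. F s x \<bullet> y) \<longlongrightarrow> T x \<bullet> y) net" by (rule tendsto_inner[OF lim tendsto_const])
    have "((\<lambda>s. x \<bullet> F s y) \<longlongrightarrow> x \<bullet> T y) net" by (rule tendsto_inner[OF tendsto_const lim])
    then show "((\<lambda>s. F s x \<bullet> y) \<longlongrightarrow> x \<bullet> T y) net"
      by (rule Lim_transform_eventually)
        (use assms(3) in eventually_elim, simp add: symmetric_opD)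
  qed
  ultimately show ?thesis
    by (simp add: symmetric_op_def bounded_operators_def)
qed

section \<open>Positivity and invertibility\<close>

text \<open>\<open>H x = y\<close> is solved by a fixed point of
  \<open>x - s *\<^sub>R (H x - y)\<close>, a contraction for small \<open>s\<close>; the lower
  bound also gives injectivity and a bounded inverse.\<close>

lemma positive_op_bounded_below_regular:
  fixes H :: "'a::separable_hilbert_space \<Rightarrow>\<^sub>L 'a"
  assumes bo: "H \<in> bounded_operators" and e: "e > 0" and H: "\<And>x. H x \<bullet> x \<ge> e * (norm x)\<^sup>2"
  shows "regular_op H"
proof -
  define N where "N = norm H + e"
  have N: "N \<ge> norm H" "N > 0" "e \<le> N" using e by (auto simp: N_def add_nonneg_pos)
  \<comment> \<open>This step size minimizes \<open>1 - 2 * s * e + s\<^sup>2 * N\<^sup>2\<close>,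
    with minimum \<open>1 - s * e\<close>. Adding \<open>e\<close> to the norm in \<open>N\<close>
    ensures \<open>e \<le> N\<close>, so that this value is not negative.\<close>
  define s where "s = e / N\<^sup>2"
  have s: "s > 0" using e N by (simp add: s_def)
  define c where "c = sqrt (1 - s * e)"
  have "e * e \<le> N * N" by (intro mult_mono) (use N e in auto)
  then have se: "s * e \<le> 1" using N by (simp add: s_def power2_eq_square divide_le_eq)
  have c: "0 \<le> c" "c < 1" using se s e by (auto simp: c_def real_less_lsqrt)
  have contr: "norm (x - s *\<^sub>R H x) \<le> c * norm x" for x
  proof -
    have nH: "norm (H x) \<le> N * norm x"
      using norm_blinfun[of H x] N by (meson mult_right_mono norm_ge_zero order_trans)
    have "(norm (x - s *\<^sub>R H x))\<^sup>2 = (norm x)\<^sup>2 - 2 * s * (H x \<bullet> x) + s\<^sup>2 * (norm (H x))\<^sup>2"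
      unfolding power2_norm_eq_inner
      by (simp add: inner_diff_left inner_diff_right inner_commute power2_eq_square algebra_simps)
    also have "\<dots> \<le> (norm x)\<^sup>2 - 2 * s * (e * (norm x)\<^sup>2) + s\<^sup>2 * (N * norm x)\<^sup>2"
      using H[of x] s nH by (intro add_mono diff_mono mult_left_mono power_mono) auto
    also have "s\<^sup>2 * (N * norm x)\<^sup>2 = s * e * (norm x)\<^sup>2"
      using N by (simp add: s_def power2_eq_square)
    also have "(norm x)\<^sup>2 - 2 * s * (e * (norm x)\<^sup>2) + s * e * (norm x)\<^sup>2 = (c * norm x)\<^sup>2"
      using se by (simp add: c_def power_mult_distrib algebra_simps)
    finally show ?thesis
      using c by (simp add: power2_le_iff_abs_le abs_mult)
  qed
  have ex: "\<exists>x. H x = y" for y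
  proof -
    have "\<exists>!x. x - s *\<^sub>R (H x - y) = x"
    proof (rule banach_fix_type[OF c], intro allI)
      fix u v
      have "(u - s *\<^sub>R (H u - y)) - (v - s *\<^sub>R (H v - y)) = (u - v) - s *\<^sub>R H (u - v)"
        by (simp add: blinfun.diff_right algebra_simps)
      then show "dist (u - s *\<^sub>R (H u - y)) (v - s *\<^sub>R (H v - y)) \<le> c * dist u v"
        using contr[of "u - v"] unfolding dist_norm by (simp only:)
    qed
    then show ?thesis using s by auto
  qed
  define J where "J = (\<lambda>y. SOME x. H x = y)"
  have HJ: "H (J y) = y" for y
    using someI_ex[OF ex[of y]] by (simp add: J_def)
  have below: "e * norm x \<le> norm (H x)" for x
  proof (cases "x = 0")
    case False
    have "e * (norm x)\<^sup>2 \<le> norm (H x) * norm x"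
      using H[of x] norm_cauchy_schwarz[of "H x" x] by linarith
    with False show ?thesis by (simp add: power2_eq_square)
  qed simp
  have inj: "x = y" if "H x = H y" for x y
  proof -
    have "e * norm (x - y) \<le> 0" using below[of "x - y"] that by (simp add: blinfun.diff_right)
    with e show ?thesis by (simp add: mult_le_0_iff)
  qed
  have blJ: "bounded_linear J"
  proof (rule bounded_linear_intro[where K = "1 / e"])
    show "J (x + y) = J x + J y" for x y by (rule inj) (simp add: HJ blinfun.add_right)
    show "J (r *\<^sub>R x) = r *\<^sub>R J x" for r x by (rule inj) (simp add: HJ blinfun.scaleR_right)
    show "norm (J x) \<le> norm x * (1 / e)" for x
      using below[of "J x"] e by (simp add: HJ field_simps)
  qed
  define K where "K = Blinfun J"
  have K: "blinfun_apply K = J" by (simp add: K_def bounded_linear_Blinfun_apply blJ)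
  have "K \<in> bounded_operators"
    unfolding bounded_operators_def mem_Collect_eq K
    by (intro allI, rule inj) (simp add: HJ bounded_operators_scaleC[OF bo])
  moreover have "K o\<^sub>L H = id_blinfun" by (rule blinfun_eqI, rule inj) (simp add: K HJ)
  moreover have "H o\<^sub>L K = id_blinfun" by (rule blinfun_eqI) (simp add: K HJ)
  ultimately show ?thesis using bo by (auto simp: regular_op_def)
qed

text \<open>This is \<open>T\<^sup>2 \<le> norm T * T\<close>, obtained without a square root by
  evaluating the form of \<open>T\<close> at \<open>x - s *\<^sub>R T x\<close> with
  \<open>s = 1 / norm T\<close>.\<close>

lemma positive_op_norm_le_inner:
  assumes "positive_op T"
  shows "(norm (T x))\<^sup>2 \<le> norm T * (T x \<bullet> x)"
proof (cases "norm T = 0")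
  case False
  define s where "s = 1 / norm T"
  have s: "s > 0" "s * norm T = 1" using False by (auto simp: s_def)
  have sym: "symmetric_op T" using assms by (rule positive_op_symmetric)
  have "0 \<le> T (x - s *\<^sub>R T x) \<bullet> (x - s *\<^sub>R T x)" by (rule positive_opD[OF assms])
  also have "\<dots> = T x \<bullet> x - 2 * s * (norm (T x))\<^sup>2 + s\<^sup>2 * (T (T x) \<bullet> T x)"
    using symmetric_opD[OF sym, of "T x" x] unfolding power2_norm_eq_inner
    by (simp add: blinfun.bilinear_simps inner_diff_left inner_diff_right
        power2_eq_square algebra_simps)
  also have "T (T x) \<bullet> T x \<le> norm T * (norm (T x))\<^sup>2"
  proof -
    have "T (T x) \<bullet> T x \<le> norm (T (T x)) * norm (T x)" by (rule norm_cauchy_schwarz)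
    also have "\<dots> \<le> (norm T * norm (T x)) * norm (T x)"
      by (intro mult_right_mono norm_blinfun) simp
    finally show ?thesis by (simp add: power2_eq_square mult.assoc)
  qed
  then have "T x \<bullet> x - 2 * s * (norm (T x))\<^sup>2 + s\<^sup>2 * (T (T x) \<bullet> T x)
      \<le> T x \<bullet> x - 2 * s * (norm (T x))\<^sup>2 + s\<^sup>2 * (norm T * (norm (T x))\<^sup>2)"
    by (intro add_left_mono mult_left_mono) auto
  also have "s\<^sup>2 * (norm T * (norm (T x))\<^sup>2) = s * (norm (T x))\<^sup>2"
    using s by (simp add: power2_eq_square mult.assoc[symmetric])
  finally have "s * (norm (T x))\<^sup>2 \<le> T x \<bullet> x" by simp
  then show ?thesis using False by (simp add: s_def field_simps)
qed simp

text \<open>The inverse bounds \<open>norm x\<close> by a multiple of \<open>norm (T x)\<close>, and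
  \<open>positive_op_norm_le_inner\<close> turns this into a bound by the quadratic form.\<close>

lemma positive_regular_bounded_below:
  assumes T: "positive_op T" "regular_op T"
  obtains e where "e > 0" "\<And>x. T x \<bullet> x \<ge> e * (norm x)\<^sup>2"
proof -
  from T obtain S where S: "S o\<^sub>L T = id_blinfun" by (auto simp: regular_op_def)
  \<comment> \<open>The summand \<open>1\<close> keeps \<open>K\<close> positive on the zero
    space.\<close>
  define K where "K = (norm S)\<^sup>2 * norm T + 1"
  have K: "K > 0" by (simp add: K_def add_nonneg_pos)
  have "T x \<bullet> x \<ge> (1 / K) * (norm x)\<^sup>2" for x
  proof -
    have "x = S (T x)" using S by (metis blinfun_apply_blinfun_compose blinfun_apply_id_blinfun id_apply)
    then have "norm x \<le> norm S * norm (T x)" using norm_blinfun by metis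
    then have "(norm x)\<^sup>2 \<le> (norm S)\<^sup>2 * (norm (T x))\<^sup>2"
      by (metis norm_ge_zero power_mono power_mult_distrib)
    also have "\<dots> \<le> (norm S)\<^sup>2 * (norm T * (T x \<bullet> x))"
      by (intro mult_left_mono positive_op_norm_le_inner T) auto
    also have "\<dots> \<le> K * (T x \<bullet> x)"
      using positive_opD[OF T(1), of x] by (simp add: K_def algebra_simps)
    finally show ?thesis using K by (simp add: field_simps)
  qed
  then show thesis using K that[of "1 / K"] by simp
qed

section \<open>Polynomials of a symmetric operator\<close>

lemma regular_op_compose:
  assumes "regular_op S" "regular_op T"
  shows "regular_op (S o\<^sub>L T)"
proof -
  obtain S' T' where *: "S' \<in> bounded_operators" "T' \<in> bounded_operators"
    "S' o\<^sub>L S = id_blinfun" "S o\<^sub>L S' = id_blinfun" "T' o\<^sub>L T = id_blinfun" "T o\<^sub>L T' = id_blinfun"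
    using assms by (auto simp: regular_op_def)
  have "S' (S x) = x" "S (S' x) = x" "T' (T x) = x" "T (T' x) = x" for x
    using *(3-6) by (metis blinfun_apply_blinfun_compose blinfun_apply_id_blinfun id_apply)+
  then have "(T' o\<^sub>L S') o\<^sub>L (S o\<^sub>L T) = id_blinfun" "(S o\<^sub>L T) o\<^sub>L (T' o\<^sub>L S') = id_blinfun"
    by (auto intro!: blinfun_eqI)
  with * assms show ?thesis
    unfolding regular_op_def by (blast intro: bounded_operators_compose)
qed

lemma regular_op_scaleR:
  assumes "regular_op T" "r \<noteq> 0"
  shows "regular_op (r *\<^sub>R T)"
proof -
  obtain S where S: "S \<in> bounded_operators" "S o\<^sub>L T = id_blinfun" "T o\<^sub>L S = id_blinfun"
    using assms by (auto simp: regular_op_def)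
  have "(inverse r *\<^sub>R S) o\<^sub>L (r *\<^sub>R T) = id_blinfun" "(r *\<^sub>R T) o\<^sub>L (inverse r *\<^sub>R S) = id_blinfun"
    using S(2,3) assms(2)
    by (simp_all add: bounded_bilinear.scaleR_left[OF bounded_bilinear_blinfun_compose]
        bounded_bilinear.scaleR_right[OF bounded_bilinear_blinfun_compose])
  with S assms show ?thesis
    unfolding regular_op_def by (blast intro: bounded_operators_scaleR)
qed

lemma regular_op_id: "regular_op id_blinfun"
  unfolding regular_op_def
  by (auto simp: bounded_operators_id intro!: bexI[of _ id_blinfun] blinfun_eqI)

section \<open>The algebra of polynomials in an operator\<close>

lemma op_poly_0 [simp]: "op_poly 0 T = 0"
  by (simp add: op_poly_def)

lemma blinfun_compose_id [simp]: "T o\<^sub>L id_blinfun = T" "id_blinfun o\<^sub>L T = T"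
  by (auto intro: blinfun_eqI)

text \<open>Horner's recursion, which opens polynomial identities to induction over
  \<open>pCons\<close>.\<close>

lemma op_poly_pCons [simp]: "op_poly (pCons a p) T = a *\<^sub>R id_blinfun + (T o\<^sub>L op_poly p T)"
proof (cases "p = 0")
  case True
  then show ?thesis
    by (simp add: op_poly_def)
next
  case False
  have "op_poly (pCons a p) T
      = a *\<^sub>R id_blinfun + (\<Sum>i\<le>degree p. coeff p i *\<^sub>R (T o\<^sub>L (((o\<^sub>L) T ^^ i) id_blinfun)))"
    using False by (simp add: op_poly_def sum.atMost_Suc_shift del: sum.atMost_Suc)
  also have "(\<Sum>i\<le>degree p. coeff p i *\<^sub>R (T o\<^sub>L (((o\<^sub>L) T ^^ i) id_blinfun))) = T o\<^sub>L op_poly p T"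
    by (simp add: op_poly_def bounded_bilinear.sum_right[OF bounded_bilinear_blinfun_compose]
        bounded_bilinear.scaleR_right[OF bounded_bilinear_blinfun_compose])
  finally show ?thesis .
qed

lemma op_poly_const: "op_poly [:a:] T = a *\<^sub>R id_blinfun"
  by simp

lemma op_poly_add: "op_poly (p + q) T = op_poly p T + op_poly q T"
  by (induction p q rule: poly_induct2)
    (auto intro!: blinfun_eqI simp: blinfun.bilinear_simps algebra_simps)

lemma op_poly_smult: "op_poly (smult a p) T = a *\<^sub>R op_poly p T"
  by (induction p) (auto intro!: blinfun_eqI simp: blinfun.bilinear_simps algebra_simps)

lemma op_poly_diff: "op_poly (p - q) T = op_poly p T - op_poly q T"
  using op_poly_add[of "p - q" q T] by simp

lemma op_poly_mult: "op_poly (p * q) T = op_poly p T o\<^sub>L op_poly q T"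
  by (induction p)
    (auto intro!: blinfun_eqI simp: op_poly_add op_poly_smult blinfun.bilinear_simps)

lemma op_poly_pcompose: "op_poly (pcompose p q) T = op_poly p (op_poly q T)"
  by (induction p) (simp_all add: pcompose_pCons op_poly_add op_poly_mult)

lemma op_poly_commute:
  assumes "S o\<^sub>L T = T o\<^sub>L S"
  shows "S o\<^sub>L op_poly p T = op_poly p T o\<^sub>L S"
proof -
  have ST: "S (T x) = T (S x)" for x
    using assms by (metis blinfun_apply_blinfun_compose)
  have "S (op_poly p T x) = op_poly p T (S x)" for x
    by (induction p arbitrary: x) (auto simp: blinfun.bilinear_simps ST)
  then show ?thesis by (auto intro: blinfun_eqI)
qed

lemma symmetric_op_poly:
  assumes "symmetric_op T"
  shows "symmetric_op (op_poly p T)"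
proof (induction p)
  case 0
  have "symmetric_op (0 *\<^sub>R id_blinfun)" by (rule symmetric_op_scaleR[OF symmetric_op_id])
  then show ?case by simp
next
  case (pCons a p)
  have "T o\<^sub>L op_poly p T = op_poly p T o\<^sub>L T" by (rule op_poly_commute) simp
  with pCons show ?case
    by (auto intro!: symmetric_op_add symmetric_op_scaleR symmetric_op_id symmetric_op_compose assms)
qed

text \<open>The set on which \<open>functional_calculus\<close> demands uniform convergence;
  membership involves real scalars only.\<close>

definition real_spectrum :: "('a::separable_hilbert_space \<Rightarrow>\<^sub>L 'a) \<Rightarrow> real set"
  where "real_spectrum T = {t. complex_of_real t \<in> op_spectrum T}"

lemma real_spectrum_iff: "t \<in> real_spectrum T \<longleftrightarrow> \<not> regular_op (t *\<^sub>R id_blinfun - T)"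
  by (simp add: real_spectrum_def op_spectrum_def op_scaleC_of_real)

text \<open>Half of the spectral mapping theorem, by splitting off real factors. A real root is
  outside the spectrum, so its linear factor is regular; a non-real root gives a quadratic factor
  that is bounded below.\<close>

lemma op_poly_regular:
  assumes T: "symmetric_op T"
  shows "p \<noteq> 0 \<Longrightarrow> (\<And>t. t \<in> real_spectrum T \<Longrightarrow> poly p t \<noteq> 0) \<Longrightarrow> regular_op (op_poly p T)"
proof (induction "degree p" arbitrary: p rule: less_induct)
  case less
  show ?case
  proof (cases "degree p = 0")
    case True
    then obtain c where "p = [:c:]" by (rule degree_eq_zeroE)
    with less.prems show ?thesis by (simp add: regular_op_scaleR regular_op_id)
  next
    case False
    \<comment> \<open>Complex evaluation of a real polynomial. The ring laws that follow carry a
      complex root through division with remainder.\<close>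
    define E where "E = (\<lambda>q z. poly (map_poly complex_of_real q) z)"
    have E_pCons: "E (pCons a q) z = of_real a + z * E q z" for a q z
      by (simp add: E_def map_poly_pCons)
    have E_0: "E 0 z = 0" for z by (simp add: E_def)
    have E_add: "E (q + r) z = E q z + E r z" for q r z
      by (induction q r rule: poly_induct2) (simp_all add: E_0 E_pCons algebra_simps)
    have E_smult: "E (smult a q) z = of_real a * E q z" for a q z
      by (induction q) (simp_all add: E_0 E_pCons algebra_simps)
    have E_mult: "E (q * r) z = E q z * E r z" for q r z
      by (induction q) (simp_all add: E_0 E_pCons E_add E_smult algebra_simps)
    have E_real: "E q (of_real x) = of_real (poly q x)" for q x
      by (induction q) (simp_all add: E_0 E_pCons)
    have "\<not> constant (poly (map_poly complex_of_real p))"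
      using False by (simp add: constant_degree degree_map_poly)
    then obtain z where z: "E p z = 0"
      unfolding E_def using fundamental_theorem_of_algebra by blast
    obtain q r where pqr: "p = q * r" "regular_op (op_poly q T)" "degree q > 0"
    proof (cases "Im z = 0")
      case True
      then have z_real: "z = of_real (Re z)" by (simp add: complex_eq_iff)
      have root: "poly p (Re z) = 0" using z E_real[of p "Re z"] z_real by simp
      then obtain r where r: "p = [:- Re z, 1:] * r"
        by (auto simp: poly_eq_0_iff_dvd elim: dvdE)
      from root less.prems(2) have "Re z \<notin> real_spectrum T" by blast
      then have "regular_op (Re z *\<^sub>R id_blinfun - T)" by (simp add: real_spectrum_iff)
      then have "regular_op ((-1) *\<^sub>R (Re z *\<^sub>R id_blinfun - T))" by (rule regular_op_scaleR) simp
      then have "regular_op (op_poly [:- Re z, 1:] T)"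
        by (simp add: algebra_simps)
      with r show thesis by (rule that) simp
    next
      case False
      define a b where ab: "a = Re z" "b = Im z"
      have b: "b \<noteq> 0" using False ab by simp
      \<comment> \<open>This is \<open>(t - a)\<^sup>2 + b\<^sup>2\<close>. The remainder modulo
        \<open>Q\<close> is real, of degree at most one, and vanishes at a non-real point, hence is
        zero; and \<open>Q(T)\<close> is bounded below by \<open>b\<^sup>2\<close>.\<close>
      define Q where "Q = [:a\<^sup>2 + b\<^sup>2, - 2 * a, 1:]"
      have "E Q z = 0"
        by (simp add: Q_def E_pCons E_0 ab complex_eq_iff power2_eq_square)
      then have mod0: "E (p mod Q) z = 0"
        using z E_add[of "(p div Q) * Q" "p mod Q" z] by (simp add: E_mult)
      have "p mod Q = 0"
      proof (rule ccontr)
        assume nz: "p mod Q \<noteq> 0"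
        have "degree (p mod Q) < degree Q"
          using nz by (intro degree_mod_less') (auto simp: Q_def)
        then have "degree (p mod Q) \<le> 1" by (simp add: Q_def)
        then obtain u v where uv: "p mod Q = [:u, v:]"
          by (metis One_nat_def degree_eq_zeroE degree_pCons_eq_if le_Suc_eq le_zero_eq
              pCons_cases nat.inject pCons_0_0 degree_0)
        have "of_real u + z * of_real v = 0" using mod0 by (simp add: uv E_pCons E_0)
        then have "v = 0 \<and> u = 0" using b ab by (auto simp: complex_eq_iff)
        with nz uv show False by simp
      qed
      then have p: "p = Q * (p div Q)" by (metis add.right_neutral mult.commute div_mult_mod_eq)
      have "op_poly Q T x \<bullet> x \<ge> b\<^sup>2 * (norm x)\<^sup>2" for x
      proof -
        have "op_poly Q T x \<bullet> x = ((T x - a *\<^sub>R x) \<bullet> (T x - a *\<^sub>R x)) + b\<^sup>2 * (x \<bullet> x)"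
          using symmetric_opD[OF T, of "T x" x]
          by (simp add: Q_def blinfun.bilinear_simps inner_add_left inner_diff_left inner_diff_right
              inner_commute power2_eq_square algebra_simps)
        then show ?thesis by (simp add: power2_norm_eq_inner)
      qed
      then have "regular_op (op_poly Q T)"
        using b by (intro positive_op_bounded_below_regular[of _ "b\<^sup>2"]
            symmetric_op_bounded symmetric_op_poly T) auto
      with p show thesis by (intro that[of Q "p div Q"]) (auto simp: Q_def)
    qed
    have "r \<noteq> 0" "q \<noteq> 0" using pqr less.prems(1) by auto
    then have "degree r < degree p" using pqr by (simp add: degree_mult_eq)
    moreover have "poly r t \<noteq> 0" if "t \<in> real_spectrum T" for t
      using less.prems(2)[OF that] pqr(1) by simp
    ultimately have "regular_op (op_poly r T)" using less.hyps \<open>r \<noteq> 0\<close> by blast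
    with pqr show ?thesis by (simp add: op_poly_mult regular_op_compose)
  qed
qed

text \<open>Regularity of this positive operator would bound it below by some \<open>e > 0\<close>,
  giving \<open>norm H\<close> at most the root of \<open>(norm H)\<^sup>2 - e\<close>. The vector
  \<open>x0\<close> excludes the zero space, where every operator is regular.\<close>

lemma norm_square_minus_square_not_regular:
  fixes H :: "'a::separable_hilbert_space \<Rightarrow>\<^sub>L 'a" and x0 :: 'a
  assumes H: "symmetric_op H" and x0: "x0 \<noteq> 0"
  shows "\<not> regular_op ((norm H)\<^sup>2 *\<^sub>R id_blinfun - (H o\<^sub>L H))"
proof
  let ?D = "(norm H)\<^sup>2 *\<^sub>R id_blinfun - (H o\<^sub>L H)"
  assume reg: "regular_op ?D"
  have D: "?D x \<bullet> x = (norm H)\<^sup>2 * (norm x)\<^sup>2 - (norm (H x))\<^sup>2" for x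
    using symmetric_opD[OF H, of "H x" x]
    by (simp add: blinfun.bilinear_simps inner_diff_left power2_norm_eq_inner)
  have "positive_op ?D"
    unfolding positive_op_iff
  proof (intro conjI allI)
    show "symmetric_op ?D"
      by (intro symmetric_op_diff symmetric_op_scaleR symmetric_op_id symmetric_op_compose H refl)
    show "?D x \<bullet> x \<ge> 0" for x
      unfolding D using norm_blinfun[of H x]
      by (metis diff_ge_0_iff_ge norm_ge_zero power_mono power_mult_distrib)
  qed
  then obtain e where e: "e > 0" "\<And>x. ?D x \<bullet> x \<ge> e * (norm x)\<^sup>2"
    using reg by (rule positive_regular_bounded_below) blast
  define k where "k = (norm H)\<^sup>2 - e"
  have le: "(norm (H x))\<^sup>2 \<le> k * (norm x)\<^sup>2" for x
    using e(2)[of x] unfolding D by (simp add: k_def algebra_simps)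
  have "0 \<le> k * (norm x0)\<^sup>2" using le[of x0] by (meson order_trans zero_le_power2)
  then have k: "k \<ge> 0" using x0 by (simp add: zero_le_mult_iff)
  have "norm H \<le> sqrt k"
  proof (rule norm_blinfun_bound)
    fix x
    have "norm (H x) = sqrt ((norm (H x))\<^sup>2)" by simp
    also have "\<dots> \<le> sqrt (k * (norm x)\<^sup>2)" using le by (rule real_sqrt_le_mono)
    also have "\<dots> = sqrt k * norm x" by (simp add: real_sqrt_mult)
    finally show "norm (H x) \<le> sqrt k * norm x" .
  qed (use k in simp)
  then have "(norm H)\<^sup>2 \<le> (sqrt k)\<^sup>2" by (rule power_mono) simp
  with k e show False by (simp add: k_def)
qed

text \<open>On an empty spectrum no polynomial has a zero, so \<open>op_poly_regular\<close> would
  make \<open>(norm T)\<^sup>2 - T\<^sup>2\<close> regular.\<close>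

lemma real_spectrum_nonempty:
  fixes T :: "'a::separable_hilbert_space \<Rightarrow>\<^sub>L 'a" and x0 :: 'a
  assumes "symmetric_op T" "x0 \<noteq> 0"
  shows "real_spectrum T \<noteq> {}"
proof
  assume "real_spectrum T = {}"
  then have "regular_op (op_poly [:(norm T)\<^sup>2, 0, -1:] T)"
    by (intro op_poly_regular assms) auto
  moreover have "op_poly [:(norm T)\<^sup>2, 0, -1:] T = (norm T)\<^sup>2 *\<^sub>R id_blinfun - (T o\<^sub>L T)"
    by (auto intro!: blinfun_eqI simp: blinfun.bilinear_simps)
  ultimately show False
    using norm_square_minus_square_not_regular[OF assms] by simp
qed

text \<open>If \<open>H = p(T)\<close> had norm above \<open>e\<close>, the polynomial
  \<open>(norm H)\<^sup>2 - p\<^sup>2\<close> would have no zero on the spectrum, so its value at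
  \<open>T\<close> would be regular, which the previous lemmas exclude.\<close>

lemma norm_op_poly_le:
  fixes T :: "'a::separable_hilbert_space \<Rightarrow>\<^sub>L 'a"
  assumes T: "symmetric_op T" and "e \<ge> 0" and bound: "\<And>t. t \<in> real_spectrum T \<Longrightarrow> \<bar>poly p t\<bar> \<le> e"
  shows "norm (op_poly p T) \<le> e"
proof (cases "\<exists>x0 :: 'a. x0 \<noteq> 0")
  case True
  then obtain x0 :: 'a where x0: "x0 \<noteq> 0" by blast
  show ?thesis
  proof (rule ccontr)
    define H where "H = op_poly p T"
    assume "\<not> norm (op_poly p T) \<le> e"
    then have m: "norm H > e" by (simp add: H_def)
    define P where "P = [:(norm H)\<^sup>2:] - p * p"
    have nz: "poly P t \<noteq> 0" if "t \<in> real_spectrum T" for t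
    proof -
      have "\<bar>poly p t\<bar> < norm H" using bound[OF that] m by simp
      then have "(poly p t)\<^sup>2 < (norm H)\<^sup>2" by (metis power2_abs abs_ge_zero power_strict_mono pos2)
      then show ?thesis by (simp add: P_def power2_eq_square)
    qed
    \<comment> \<open>A polynomial without zeros on the spectrum is non-zero only because the
      spectrum has a point.\<close>
    moreover have "P \<noteq> 0" using nz real_spectrum_nonempty[OF T x0] by auto
    ultimately have "regular_op (op_poly P T)" by (intro op_poly_regular T)
    moreover have "op_poly P T = (norm H)\<^sup>2 *\<^sub>R id_blinfun - (H o\<^sub>L H)"
      by (simp only: P_def H_def op_poly_diff op_poly_mult op_poly_const)
    moreover have "symmetric_op H" unfolding H_def by (rule symmetric_op_poly[OF T])
    ultimately show False
      using norm_square_minus_square_not_regular[OF _ x0] by simp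
  qed
next
  case False
  then have "op_poly p T = 0" by (intro blinfun_eqI) simp
  with assms(2) show ?thesis by simp
qed

section \<open>Enclosing the spectrum in an interval\<close>

lemma inner_blinfun_le: "blinfun_apply T x \<bullet> x \<le> norm T * (norm x)\<^sup>2"
proof -
  have "T x \<bullet> x \<le> norm (T x) * norm x" by (rule norm_cauchy_schwarz)
  also have "\<dots> \<le> (norm T * norm x) * norm x"
    by (intro mult_right_mono norm_blinfun) simp
  finally show ?thesis by (simp add: power2_eq_square mult.assoc)
qed

lemma real_spectrum_subset:
  assumes T: "symmetric_op T" and lower: "\<And>x. T x \<bullet> x \<ge> a * (norm x)\<^sup>2" and "norm T \<le> b"
  shows "real_spectrum T \<subseteq> {a..b}"
proof
  fix t assume "t \<in> real_spectrum T"
  then have t: "\<not> regular_op (t *\<^sub>R id_blinfun - T)" by (simp add: real_spectrum_iff)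
  have bo: "t *\<^sub>R id_blinfun - T \<in> bounded_operators"
    by (intro symmetric_op_bounded symmetric_op_diff symmetric_op_scaleR symmetric_op_id T)
  show "t \<in> {a..b}"
  proof (rule ccontr)
    assume "t \<notin> {a..b}"
    then consider "t < a" | "b < t" by fastforce
    then show False
    proof cases
      case 1
      have "regular_op (T - t *\<^sub>R id_blinfun)"
      proof (rule positive_op_bounded_below_regular[where e = "a - t"])
        show "T - t *\<^sub>R id_blinfun \<in> bounded_operators"
          by (intro symmetric_op_bounded symmetric_op_diff symmetric_op_scaleR symmetric_op_id T)
        show "(T - t *\<^sub>R id_blinfun) x \<bullet> x \<ge> (a - t) * (norm x)\<^sup>2" for x
          using lower[of x]
          by (simp add: blinfun.bilinear_simps inner_diff_left power2_norm_eq_inner algebra_simps)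
      qed (use 1 in simp)
      then have "regular_op ((-1) *\<^sub>R (T - t *\<^sub>R id_blinfun))" by (rule regular_op_scaleR) simp
      with t show False by simp
    next
      case 2
      have "T x \<bullet> x \<le> b * (norm x)\<^sup>2" for x
        using inner_blinfun_le[of T x] assms(3)
        by (meson mult_right_mono order_trans zero_le_power2)
      then have "(t *\<^sub>R id_blinfun - T) x \<bullet> x \<ge> (t - b) * (norm x)\<^sup>2" for x
        by (simp add: blinfun.bilinear_simps inner_diff_left power2_norm_eq_inner algebra_simps)
      then have "regular_op (t *\<^sub>R id_blinfun - T)"
        using 2 by (intro positive_op_bounded_below_regular[where e = "t - b"] bo) auto
      with t show False by blast
    qed
  qed
qed

section \<open>Functional calculus\<close>

text \<open>Converts Stone-Weierstrass from polynomial functions to the type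
  \<open>real poly\<close>, whose elements can be applied to operators.\<close>

lemma Weierstrass_poly:
  fixes f :: "real \<Rightarrow> real"
  assumes "continuous_on {a..b} f" "e > 0"
  obtains p :: "real poly" where "\<And>t. t \<in> {a..b} \<Longrightarrow> \<bar>poly p t - f t\<bar> < e"
proof -
  obtain g where g: "real_polynomial_function g" "\<And>x. x \<in> {a..b} \<Longrightarrow> \<bar>f x - g x\<bar> < e"
    using Stone_Weierstrass_real_polynomial_function[OF compact_Icc assms] by blast
  then obtain c n where c: "g = (\<lambda>x. \<Sum>i\<le>n. c i * x ^ i)"
    unfolding real_polynomial_function_iff_sum by blast
  have "poly (\<Sum>i\<le>n. monom (c i) i) t = g t" for t
    by (simp add: c poly_sum poly_monom)
  with g(2) show thesis by (intro that[of "\<Sum>i\<le>n. monom (c i) i"]) (simp add: abs_minus_commute)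
qed

lemma Weierstrass_poly_seq:
  fixes f :: "real \<Rightarrow> real"
  assumes f: "continuous_on {a..b} f"
  obtains p :: "nat \<Rightarrow> real poly"
  where "\<And>n t. t \<in> {a..b} \<Longrightarrow> \<bar>poly (p n) t - f t\<bar> < inverse (real (Suc n))"
proof -
  have "\<exists>p. \<forall>t\<in>{a..b}. \<bar>poly p t - f t\<bar> < inverse (real (Suc n))" for n
    using Weierstrass_poly[OF f, of "inverse (real (Suc n))"]
    by (metis inverse_positive_iff_positive of_nat_0_less_iff zero_less_Suc)
  then show thesis using that by metis
qed

text \<open>Antiderivatives allow \<open>inverse\<close> to be approximated first and
  \<open>ln\<close> afterwards.\<close>

lemma ex_pderiv: "\<exists>p. pderiv p = (q :: real poly)"
proof -
  have pderiv_sum: "pderiv (sum f A) = (\<Sum>i\<in>A. pderiv (f i))" for f :: "nat \<Rightarrow> real poly" and A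
    by (induction A rule: infinite_finite_induct) (simp_all add: pderiv_add)
  have "pderiv (\<Sum>i\<le>degree q. monom (coeff q i / real (Suc i)) (Suc i))
      = (\<Sum>i\<le>degree q. monom (coeff q i) i)"
    using of_nat_neq_0
    by (simp add: pderiv_sum pderiv_monom del: of_nat_Suc)
  then show ?thesis by (metis poly_as_sum_of_monoms)
qed

text \<open>The interval is a compact domain for Weierstrass approximation; errors there bound
  errors on the spectrum.\<close>

locale symmetric_op_on =
  fixes T :: "'a::separable_hilbert_space \<Rightarrow>\<^sub>L 'a" and a b :: real
  assumes symmetric: "symmetric_op T" and spectrum: "real_spectrum T \<subseteq> {a..b}"
begin

lemma norm_op_poly_diff_le:
  assumes "e \<ge> 0" "\<And>t. t \<in> real_spectrum T \<Longrightarrow> \<bar>poly p t - poly q t\<bar> \<le> e"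
  shows "norm (op_poly p T - op_poly q T) \<le> e"
  using norm_op_poly_le[OF symmetric, of e "p - q"] assms by (simp add: op_poly_diff)

text \<open>\<open>norm_op_poly_le\<close> makes a Weierstrass sequence Cauchy and forces every
  other admissible sequence to the same limit. This shows that the definite description is well
  defined.\<close>

lemma functional_calculus_limit:
  assumes f: "continuous_on {a..b} f"
    and p: "uniform_limit (real_spectrum T) (\<lambda>n. poly (p n)) f sequentially"
  shows "(\<lambda>n. op_poly (p n) T) \<longlonglongrightarrow> functional_calculus f T"
proof -
  let ?lim = "\<lambda>S. \<forall>p. uniform_limit (real_spectrum T) (\<lambda>n. poly (p n)) f sequentially
    \<longrightarrow> (\<lambda>n. op_poly (p n) T) \<longlonglongrightarrow> S"
  have diff_null: "(\<lambda>n. op_poly (r n) T - op_poly (q n) T) \<longlonglongrightarrow> 0"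
    if r: "uniform_limit (real_spectrum T) (\<lambda>n. poly (r n)) f sequentially"
      and q: "uniform_limit (real_spectrum T) (\<lambda>n. poly (q n)) f sequentially" for r q
  proof (rule tendstoI)
    fix e :: real assume e: "e > 0"
    have "\<forall>\<^sub>F n in sequentially. \<forall>t\<in>real_spectrum T. dist (poly (r n) t) (f t) < e / 4"
      "\<forall>\<^sub>F n in sequentially. \<forall>t\<in>real_spectrum T. dist (poly (q n) t) (f t) < e / 4"
      using r q e by (auto dest!: uniform_limitD[where e = "e / 4"])
    then show "\<forall>\<^sub>F n in sequentially. dist (op_poly (r n) T - op_poly (q n) T) 0 < e"
    proof eventually_elim
      case (elim n)
      have "norm (op_poly (r n) T - op_poly (q n) T) \<le> e / 2"
      proof (rule norm_op_poly_diff_le)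
        fix t assume "t \<in> real_spectrum T"
        with elim have "dist (poly (r n) t) (f t) < e / 4" "dist (poly (q n) t) (f t) < e / 4"
          by auto
        then show "\<bar>poly (r n) t - poly (q n) t\<bar> \<le> e / 2"
          unfolding dist_real_def by linarith
      qed (use e in simp)
      then show ?case using e by simp
    qed
  qed
  obtain q where q: "\<And>n t. t \<in> {a..b} \<Longrightarrow> \<bar>poly (q n) t - f t\<bar> < inverse (real (Suc n))"
    using Weierstrass_poly_seq[OF f] by blast
  have q_unif: "uniform_limit (real_spectrum T) (\<lambda>n. poly (q n)) f sequentially"
  proof (rule uniform_limitI)
    fix e :: real assume "e > 0"
    then have "\<forall>\<^sub>F n in sequentially. inverse (real (Suc n)) < e"
      using LIMSEQ_inverse_real_of_nat order_tendstoD(2) by blast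
    then show "\<forall>\<^sub>F n in sequentially. \<forall>t\<in>real_spectrum T. dist (poly (q n) t) (f t) < e"
      by eventually_elim
        (use q spectrum in \<open>force simp: dist_real_def intro: less_trans\<close>)
  qed
  have "Cauchy (\<lambda>n. op_poly (q n) T)"
  proof (rule metric_CauchyI)
    fix e :: real assume e: "e > 0"
    then obtain N where N: "inverse (real (Suc N)) < e / 4"
      using reals_Archimedean[of "e / 4"] by auto
    have "dist (op_poly (q m) T) (op_poly (q n) T) < e" if "m \<ge> N" "n \<ge> N" for m n
    proof -
      have le: "inverse (real (Suc k)) < e / 4" if "k \<ge> N" for k
        using N that le_imp_inverse_le[of "real (Suc N)" "real (Suc k)"] by linarith
      have "norm (op_poly (q m) T - op_poly (q n) T) \<le> e / 2"
      proof (rule norm_op_poly_diff_le)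
        fix t assume "t \<in> real_spectrum T"
        then have "t \<in> {a..b}" using spectrum by blast
        with q[of t m] q[of t n] le[OF that(1)] le[OF that(2)]
        show "\<bar>poly (q m) t - poly (q n) t\<bar> \<le> e / 2" by linarith
      qed (use e in simp)
      with e show ?thesis by (simp add: dist_norm)
    qed
    then show "\<exists>M. \<forall>m\<ge>M. \<forall>n\<ge>M. dist (op_poly (q m) T) (op_poly (q n) T) < e" by blast
  qed
  then obtain S where S: "(\<lambda>n. op_poly (q n) T) \<longlonglongrightarrow> S"
    using Cauchy_convergent_iff convergent_def by blast
  have lim: "?lim S"
  proof (intro allI impI)
    fix r assume "uniform_limit (real_spectrum T) (\<lambda>n. poly (r n)) f sequentially"
    from tendsto_add[OF diff_null[OF this q_unif] S] show "(\<lambda>n. op_poly (r n) T) \<longlonglongrightarrow> S" by simp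
  qed
  have "functional_calculus f T = S"
    unfolding functional_calculus_def real_spectrum_def[symmetric]
  proof (rule the_equality)
    show "?lim S" by (rule lim)
  next
    \<comment> \<open>\<open>q\<close> witnesses that the premise in \<open>?lim\<close> can be met;
      without such a sequence \<open>?lim\<close> would be vacuous and \<open>S\<close> not
      unique.\<close>
    fix S' assume "?lim S'"
    then have "(\<lambda>n. op_poly (q n) T) \<longlonglongrightarrow> S'" using q_unif by blast
    then show "S' = S" using S LIMSEQ_unique by blast
  qed
  with lim p show ?thesis by blast
qed

text \<open>The quantitative form: one polynomial with error \<open>e\<close> on the interval
  replaces \<open>f(T)\<close> in later estimates.\<close>

lemma norm_op_poly_functional_calculus_le:
  assumes f: "continuous_on {a..b} f" and e: "e \<ge> 0"
    and p: "\<And>t. t \<in> {a..b} \<Longrightarrow> \<bar>poly p t - f t\<bar> \<le> e"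
  shows "norm (op_poly p T - functional_calculus f T) \<le> e"
proof (rule field_le_epsilon)
  fix d :: real assume d: "d > 0"
  obtain q where q: "\<And>n t. t \<in> {a..b} \<Longrightarrow> \<bar>poly (q n) t - f t\<bar> < inverse (real (Suc n))"
    using Weierstrass_poly_seq[OF f] by blast
  have small: "\<forall>\<^sub>F n in sequentially. inverse (real (Suc n)) < d'" if "d' > 0" for d'
    using LIMSEQ_inverse_real_of_nat order_tendstoD(2) that by blast
  have "uniform_limit (real_spectrum T) (\<lambda>n. poly (q n)) f sequentially"
  proof (rule uniform_limitI)
    fix d' :: real assume "d' > 0"
    from small[OF this]
    show "\<forall>\<^sub>F n in sequentially. \<forall>t\<in>real_spectrum T. dist (poly (q n) t) (f t) < d'"
      by eventually_elim
        (use q spectrum in \<open>force simp: dist_real_def intro: less_trans\<close>)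
  qed
  then have "(\<lambda>n. op_poly (q n) T) \<longlonglongrightarrow> functional_calculus f T"
    by (rule functional_calculus_limit[OF f])
  then have "\<forall>\<^sub>F n in sequentially. dist (op_poly (q n) T) (functional_calculus f T) < d / 2"
    using d by (intro tendstoD) auto
  moreover have "\<forall>\<^sub>F n in sequentially. inverse (real (Suc n)) < d / 2"
    using d by (intro small) auto
  ultimately have "\<forall>\<^sub>F n in sequentially. norm (op_poly p T - functional_calculus f T) \<le> e + d"
  proof eventually_elim
    case (elim n)
    have "norm (op_poly p T - op_poly (q n) T) \<le> e + d / 2"
    proof (rule norm_op_poly_diff_le)
      fix t assume "t \<in> real_spectrum T"
      then have "t \<in> {a..b}" using spectrum by blast
      with p[of t] q[of t n] elim(2) show "\<bar>poly p t - poly (q n) t\<bar> \<le> e + d / 2" by linarith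
    qed (use e d in simp)
    moreover have "norm (op_poly p T - functional_calculus f T)
        \<le> norm (op_poly p T - op_poly (q n) T) + norm (op_poly (q n) T - functional_calculus f T)"
      using norm_triangle_ineq[of "op_poly p T - op_poly (q n) T"
        "op_poly (q n) T - functional_calculus f T"] by simp
    ultimately show ?case using elim(1) by (simp add: dist_norm)
  qed
  then show "norm (op_poly p T - functional_calculus f T) \<le> e + d"
    by (simp add: eventually_const_iff)
qed

text \<open>Transfers norm-closed properties of polynomials in \<open>T\<close> to
  \<open>f(T)\<close>: symmetry, membership in \<open>R\<close>, commuting with
  \<open>T\<close>.\<close>

lemma functional_calculus_op_poly_seq:
  assumes f: "continuous_on {a..b} f"
  obtains p where "(\<lambda>n. op_poly (p n) T) \<longlonglongrightarrow> functional_calculus f T"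
proof -
  obtain q where q: "\<And>n t. t \<in> {a..b} \<Longrightarrow> \<bar>poly (q n) t - f t\<bar> < inverse (real (Suc n))"
    using Weierstrass_poly_seq[OF f] by blast
  have "(\<lambda>n. op_poly (q n) T - functional_calculus f T) \<longlonglongrightarrow> 0"
  proof (rule Lim_null_comparison)
    show "\<forall>\<^sub>F n in sequentially. norm (op_poly (q n) T - functional_calculus f T) \<le> inverse (real (Suc n))"
      using q by (intro always_eventually allI norm_op_poly_functional_calculus_le f)
        (auto intro: less_imp_le)
  qed (rule LIMSEQ_inverse_real_of_nat)
  then show thesis using that[of q] by (simp add: LIM_zero_iff)
qed

lemma symmetric_op_functional_calculus:
  assumes "continuous_on {a..b} f"
  shows "symmetric_op (functional_calculus f T)"
proof -
  obtain p where "(\<lambda>n. op_poly (p n) T) \<longlonglongrightarrow> functional_calculus f T"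
    using functional_calculus_op_poly_seq[OF assms] .
  then show ?thesis
    by (rule symmetric_op_limit) (simp_all add: symmetric_op_poly symmetric)
qed

end

text \<open>If \<open>q\<close> is close to \<open>sqrt\<close> on \<open>{0..N * N}\<close>, then
  \<open>q(t\<^sup>2)\<close> is close to \<open>t\<close> on \<open>{0..N}\<close>. Hence
  \<open>q(T\<^sup>2)\<close> approximates both \<open>op_abs T\<close> and
  \<open>T\<close>.\<close>

lemma op_abs_positive:
  assumes T: "positive_op T"
  shows "op_abs T = T"
proof -
  have sym: "symmetric_op T" using T by (rule positive_op_symmetric)
  define N where "N = norm T"
  have N: "N \<ge> 0" by (simp add: N_def)
  have spec_T: "real_spectrum T \<subseteq> {0..N}"
    by (rule real_spectrum_subset[OF sym]) (use T in \<open>auto simp: N_def positive_opD\<close>)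
  have sym2: "symmetric_op (T o\<^sub>L T)" by (intro symmetric_op_compose sym refl)
  have "real_spectrum (T o\<^sub>L T) \<subseteq> {0..N * N}"
  proof (rule real_spectrum_subset[OF sym2])
    show "0 * (norm x)\<^sup>2 \<le> (T o\<^sub>L T) x \<bullet> x" for x
      using symmetric_opD[OF sym, of "T x" x] by simp
    show "norm (T o\<^sub>L T) \<le> N * N" unfolding N_def by (rule norm_blinfun_compose)
  qed
  then interpret sq: symmetric_op_on "T o\<^sub>L T" 0 "N * N"
    using sym2 by unfold_locales
  interpret symmetric_op_on T 0 N using sym spec_T by unfold_locales
  have cont: "continuous_on {0..N * N} sqrt" by (intro continuous_intros)
  have adj: "op_adjoint T o\<^sub>L T = T o\<^sub>L T" by (simp add: op_adjoint_symmetric sym)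
  have "norm (T - op_abs T) \<le> 0 + e" if e: "e > 0" for e
  proof -
    obtain q where q: "\<And>t. t \<in> {0..N * N} \<Longrightarrow> \<bar>poly q t - sqrt t\<bar> < e / 2"
      using Weierstrass_poly[OF cont, of "e / 2"] e by auto
    have "norm (op_poly q (T o\<^sub>L T) - op_abs T) \<le> e / 2"
      unfolding op_abs_def adj
      using q e by (intro sq.norm_op_poly_functional_calculus_le cont) (auto intro: less_imp_le)
    moreover have "norm (op_poly [:0, 1:] T - op_poly (pcompose q [:0, 0, 1:]) T) \<le> e / 2"
    proof (rule norm_op_poly_diff_le)
      fix t assume "t \<in> real_spectrum T"
      then have t: "t \<in> {0..N}" using spectrum by blast
      then have "t * t \<in> {0..N * N}" by (auto intro: mult_mono)
      from q[OF this] t show "\<bar>poly [:0, 1:] t - poly (pcompose q [:0, 0, 1:]) t\<bar> \<le> e / 2"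
        by (simp add: poly_pcompose abs_minus_commute)
    qed (use e in simp)
    moreover have "op_poly [:0, 1:] T = T" by simp
    moreover have "op_poly (pcompose q [:0, 0, 1:]) T = op_poly q (T o\<^sub>L T)"
      by (simp add: op_poly_pcompose)
    ultimately have *: "norm (op_poly q (T o\<^sub>L T) - op_abs T) \<le> e / 2"
      "norm (T - op_poly q (T o\<^sub>L T)) \<le> e / 2" by simp_all
    have "norm (T - op_abs T) \<le> norm (T - op_poly q (T o\<^sub>L T)) + norm (op_poly q (T o\<^sub>L T) - op_abs T)"
      using norm_triangle_ineq[of "T - op_poly q (T o\<^sub>L T)" "op_poly q (T o\<^sub>L T) - op_abs T"] by simp
    with * show ?thesis by simp
  qed
  then have "norm (T - op_abs T) \<le> 0" by (rule field_le_epsilon)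
  then show ?thesis by simp
qed

section \<open>Traces on von Neumann algebras\<close>

text \<open>Matrix coefficients are norm continuous, so weakly closed sets are norm closed. This
  keeps limits of polynomials inside the algebra.\<close>

lemma von_neumann_algebra_closed:
  fixes R :: "('a::separable_hilbert_space \<Rightarrow>\<^sub>L 'a) set"
  assumes "von_neumann_algebra R"
  shows "closed R"
proof -
  let ?ev = "\<lambda>(T :: 'a \<Rightarrow>\<^sub>L 'a) (x, y). cinner (blinfun_apply T x) y"
  have "closedin weak_operator_topology R"
    using assms by (simp add: von_neumann_algebra_def)
  then have "openin weak_operator_topology (- R)"
    by (simp add: openin_closedin_eq weak_operator_topology_def topspace_pullback_topology
        Compl_eq_Diff_UNIV double_diff)
  then obtain U where U: "open U" "- R = ?ev -` U"
    by (auto simp: weak_operator_topology_def openin_pullback_topology)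
  have cinner_eq: "cinner x y = of_real (x \<bullet> y) + \<i> * of_real (((- \<i>) *\<^sub>C x) \<bullet> y)" for x y :: 'a
    by (simp add: cinner_conv_inner[of x y] complex_eq_iff)
  have "continuous_on UNIV (\<lambda>T. ?ev T i)" for i
  proof (cases i)
    case (Pair x y)
    have app: "continuous_on UNIV (\<lambda>T :: 'a \<Rightarrow>\<^sub>L 'a. blinfun_apply T x)"
      by (intro continuous_intros)
    have "continuous_on UNIV (\<lambda>T :: 'a \<Rightarrow>\<^sub>L 'a. (- \<i>) *\<^sub>C blinfun_apply T x)"
      by (rule bounded_linear.continuous_on[OF bounded_linear_scaleC app])
    then have "continuous_on UNIV (\<lambda>T :: 'a \<Rightarrow>\<^sub>L 'a. cinner (blinfun_apply T x) y)"
      unfolding cinner_eq by (intro continuous_intros app)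
    with Pair show ?thesis by simp
  qed
  then have "continuous_on UNIV ?ev"
    by (rule continuous_on_coordinatewise_then_product)
  then have "open (?ev -` U)"
    using U(1) by (simp add: continuous_on_open_vimage)
  with U show ?thesis by (simp add: closed_def)
qed

lemma blinfun_compose_assoc: "(S o\<^sub>L T) o\<^sub>L U = S o\<^sub>L (T o\<^sub>L U)"
  by (auto intro: blinfun_eqI)

lemmas blinfun_compose_simps =
  bounded_bilinear.add_left[OF bounded_bilinear_blinfun_compose]
  bounded_bilinear.add_right[OF bounded_bilinear_blinfun_compose]
  bounded_bilinear.diff_left[OF bounded_bilinear_blinfun_compose]
  bounded_bilinear.diff_right[OF bounded_bilinear_blinfun_compose]
  bounded_bilinear.scaleR_left[OF bounded_bilinear_blinfun_compose]
  bounded_bilinear.scaleR_right[OF bounded_bilinear_blinfun_compose]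

lemma positive_op_norm_minus:
  fixes T :: "'a::separable_hilbert_space \<Rightarrow>\<^sub>L 'a"
  assumes "symmetric_op T" "norm T \<le> c"
  shows "positive_op (c *\<^sub>R id_blinfun - T)"
  unfolding positive_op_iff
proof (intro conjI allI)
  show "symmetric_op (c *\<^sub>R id_blinfun - T)"
    by (intro symmetric_op_diff symmetric_op_scaleR symmetric_op_id assms)
  fix x :: 'a
  have "norm T * (norm x)\<^sup>2 \<le> c * (norm x)\<^sup>2" using assms by (intro mult_right_mono) auto
  with inner_blinfun_le[of T x] show "(c *\<^sub>R id_blinfun - T) x \<bullet> x \<ge> 0"
    by (simp add: blinfun.bilinear_simps inner_diff_left power2_norm_eq_inner)
qed

lemma positive_op_sandwich:
  assumes P: "positive_op P" and H: "symmetric_op H"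
  shows "positive_op (H o\<^sub>L P o\<^sub>L H)"
proof -
  have "(H o\<^sub>L P o\<^sub>L H) x \<bullet> y = x \<bullet> (H o\<^sub>L P o\<^sub>L H) y" for x y
    using symmetric_opD[OF H] symmetric_opD[OF positive_op_symmetric[OF P]] by simp
  moreover have "(H o\<^sub>L P o\<^sub>L H) x \<bullet> x \<ge> 0" for x
    using symmetric_opD[OF H] positive_opD[OF P, of "H x"] by simp
  ultimately show ?thesis
    using assms positive_op_symmetric[OF P]
    by (simp add: positive_op_iff symmetric_op_def bounded_operators_compose)
qed

locale tracial_von_neumann_algebra =
  fixes R :: "('a::separable_hilbert_space \<Rightarrow>\<^sub>L 'a) set" and \<tau> :: "('a \<Rightarrow>\<^sub>L 'a) \<Rightarrow> complex"
  assumes algebra: "von_neumann_algebra R" and state: "state_on R \<tau>" and tracial: "tracial_on R \<tau>"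
begin

section \<open>Closure properties of the algebra and the real-valued trace\<close>

lemma R_add: "S \<in> R \<Longrightarrow> T \<in> R \<Longrightarrow> S + T \<in> R"
  and R_compose: "S \<in> R \<Longrightarrow> T \<in> R \<Longrightarrow> S o\<^sub>L T \<in> R"
  and R_id: "id_blinfun \<in> R"
  and R_scaleR: "T \<in> R \<Longrightarrow> r *\<^sub>R T \<in> R"
  using algebra op_scaleC_of_real[of r T] unfolding von_neumann_algebra_def by metis+

lemma R_diff: "S \<in> R \<Longrightarrow> T \<in> R \<Longrightarrow> S - T \<in> R"
  using R_add[of S "(-1) *\<^sub>R T"] R_scaleR[of T "-1"] by simp

lemmas R_intros = R_add R_diff R_compose R_id R_scaleR

lemma R_limit: "F \<longlonglongrightarrow> T \<Longrightarrow> (\<And>n. F n \<in> R) \<Longrightarrow> T \<in> R"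
  using closed_sequentially[OF von_neumann_algebra_closed[OF algebra]] by blast

lemma R_op_poly: "T \<in> R \<Longrightarrow> op_poly p T \<in> R"
proof (induction p)
  case 0
  then show ?case using R_scaleR[of T 0] by simp
qed (auto intro!: R_intros)

text \<open>The determinant sees only the real part, and a real-valued functional can be ordered and
  differentiated.\<close>

definition tr :: "('a \<Rightarrow>\<^sub>L 'a) \<Rightarrow> real"
  where "tr T = Re (\<tau> T)"

lemma tr_add: "S \<in> R \<Longrightarrow> T \<in> R \<Longrightarrow> tr (S + T) = tr S + tr T"
  using state by (simp add: tr_def state_on_def)

lemma tr_scaleR: "T \<in> R \<Longrightarrow> tr (r *\<^sub>R T) = r * tr T"
  using state by (simp add: tr_def state_on_def op_scaleC_of_real[symmetric])

lemma tr_diff: "S \<in> R \<Longrightarrow> T \<in> R \<Longrightarrow> tr (S - T) = tr S - tr T"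
  using tr_add[of "S - T" T] R_diff[of S T] by simp

lemma tr_id: "tr id_blinfun = 1"
  using state by (simp add: tr_def state_on_def)

lemma tr_nonneg: "T \<in> R \<Longrightarrow> positive_op T \<Longrightarrow> tr T \<ge> 0"
  using state by (simp add: tr_def state_on_def complex_nonneg_Reals_iff)

lemma tr_commute: "S \<in> R \<Longrightarrow> T \<in> R \<Longrightarrow> tr (S o\<^sub>L T) = tr (T o\<^sub>L S)"
  using tracial by (simp add: tr_def tracial_on_def)

text \<open>A symmetric \<open>T\<close> lies between \<open>- norm T\<close> and
  \<open>norm T\<close> times the identity, which has trace \<open>1\<close>.\<close>

lemma abs_tr_le:
  assumes "T \<in> R" "symmetric_op T"
  shows "\<bar>tr T\<bar> \<le> norm T"
proof -
  have "positive_op (norm T *\<^sub>R id_blinfun - T)"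
    by (intro positive_op_norm_minus assms order_refl)
  from tr_nonneg[OF _ this] have "tr T \<le> norm T"
    using assms by (simp add: tr_diff tr_scaleR tr_id R_intros)
  have "positive_op (norm T *\<^sub>R id_blinfun - (-1) *\<^sub>R T)"
    by (intro positive_op_norm_minus symmetric_op_scaleR assms) simp
  from tr_nonneg[OF _ this] have "- tr T \<le> norm T"
    using assms by (simp only: tr_diff tr_scaleR tr_id R_intros) simp
  with \<open>tr T \<le> norm T\<close> show ?thesis by simp
qed

text \<open>A product of symmetric operators has the trace of its symmetrization.\<close>

lemma abs_tr_compose_le:
  assumes "S \<in> R" "symmetric_op S" "T \<in> R" "symmetric_op T"
  shows "\<bar>tr (S o\<^sub>L T)\<bar> \<le> norm S * norm T"
proof -
  let ?J = "(S o\<^sub>L T) + (T o\<^sub>L S)"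
  have "2 * tr (S o\<^sub>L T) = tr ?J"
    using assms tr_commute[of S T] by (simp add: tr_add R_intros)
  moreover have "\<bar>tr ?J\<bar> \<le> norm ?J"
    using assms by (intro abs_tr_le symmetric_op_jordan R_intros)
  moreover have "norm ?J \<le> norm S * norm T + norm T * norm S"
    by (intro order_trans[OF norm_triangle_ineq] add_mono norm_blinfun_compose)
  ultimately show ?thesis by simp
qed

text \<open>The square root of the second factor is approximated by polynomials \<open>q (T)\<close>, and
  \<open>tr (S q(T)\<^sup>2) = tr (q(T) S q(T))\<close>.\<close>

lemma tr_compose_nonneg:
  assumes S: "S \<in> R" "positive_op S" and T: "T \<in> R" "positive_op T"
  shows "tr (S o\<^sub>L T) \<ge> 0"
proof (rule field_le_epsilon)
  fix d :: real assume d: "d > 0"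
  define N where "N = norm T"
  have N: "N \<ge> 0" by (simp add: N_def)
  \<comment> \<open>Chosen so that \<open>norm S * e \<le> d\<close>; the \<open>1\<close> avoids
    division by zero.\<close>
  define e where "e = d / (norm S + 1)"
  have e: "e > 0" using d by (simp add: e_def add_nonneg_pos)
  have symS: "symmetric_op S" and symT: "symmetric_op T"
    using S T by (auto intro: positive_op_symmetric)
  have "real_spectrum T \<subseteq> {0..N}"
    by (rule real_spectrum_subset[OF symT]) (use T in \<open>auto simp: N_def positive_opD\<close>)
  then interpret symmetric_op_on T 0 N using symT by unfold_locales
  \<comment> \<open>With \<open>u = poly q t - sqrt t\<close>, the error of \<open>q\<^sup>2\<close>
    at \<open>t\<close> is \<open>u * (u + 2 * sqrt t)\<close>; for
    \<open>\<bar>u\<bar> \<le> c \<le> 1\<close> it is at most \<open>c * k\<close>.\<close>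
  define k where "k = 1 + 2 * sqrt N"
  have k: "k > 0" using N by (simp add: k_def add_pos_nonneg)
  define c where "c = min 1 (e / k)"
  have c: "c > 0" "c \<le> 1" "c * k \<le> e"
    using e k by (auto simp: c_def min_def field_simps)
  have cont: "continuous_on {0..N} sqrt" by (intro continuous_intros)
  obtain q where q: "\<And>t. t \<in> {0..N} \<Longrightarrow> \<bar>poly q t - sqrt t\<bar> < c"
    using Weierstrass_poly[OF cont c(1)] by blast
  let ?H = "op_poly q T"
  have symH: "symmetric_op ?H" by (rule symmetric_op_poly[OF symT])
  have HR: "?H \<in> R" by (rule R_op_poly[OF T(1)])
  have "norm (op_poly [:0, 1:] T - op_poly (q * q) T) \<le> e"
  proof (rule norm_op_poly_diff_le)
    fix t assume "t \<in> real_spectrum T"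
    then have t: "t \<in> {0..N}" using spectrum by blast
    let ?u = "poly q t - sqrt t"
    have "poly [:0, 1:] t - poly (q * q) t = - (?u * (?u + 2 * sqrt t))"
      using t by (simp add: algebra_simps)
    then have "\<bar>poly [:0, 1:] t - poly (q * q) t\<bar> = \<bar>?u\<bar> * \<bar>?u + 2 * sqrt t\<bar>"
      by (simp add: abs_mult)
    also have "\<dots> \<le> c * k"
      unfolding k_def
    proof (intro mult_mono)
      have "sqrt t \<le> sqrt N" "sqrt t \<ge> 0" using t by auto
      with q[OF t] c show "\<bar>?u + 2 * sqrt t\<bar> \<le> 1 + 2 * sqrt N" by linarith
    qed (use q[OF t] c in auto)
    finally show "\<bar>poly [:0, 1:] t - poly (q * q) t\<bar> \<le> e" using c by simp
  qed (use e in simp)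
  then have close: "norm (T - (?H o\<^sub>L ?H)) \<le> e" by (simp add: op_poly_mult)
  have "tr (S o\<^sub>L (?H o\<^sub>L ?H)) = tr (?H o\<^sub>L S o\<^sub>L ?H)"
    using tr_commute[of "S o\<^sub>L ?H" ?H] S HR by (simp add: blinfun_compose_assoc R_intros)
  moreover have "\<dots> \<ge> 0"
    by (intro tr_nonneg positive_op_sandwich symH S R_intros HR)
  moreover have "tr (S o\<^sub>L T) = tr (S o\<^sub>L (?H o\<^sub>L ?H)) + tr (S o\<^sub>L (T - (?H o\<^sub>L ?H)))"
    using S T HR by (simp add: tr_add[symmetric] R_intros blinfun_compose_simps)
  moreover have "\<bar>tr (S o\<^sub>L (T - (?H o\<^sub>L ?H)))\<bar> \<le> norm S * norm (T - (?H o\<^sub>L ?H))"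
    using S T HR
    by (intro abs_tr_compose_le R_intros symmetric_op_diff symS symT symmetric_op_compose symH refl)
  moreover have "norm S * norm (T - (?H o\<^sub>L ?H)) \<le> d"
  proof -
    have "norm S * norm (T - (?H o\<^sub>L ?H)) \<le> norm S * e" using close by (intro mult_left_mono) auto
    also have "\<dots> \<le> (norm S + 1) * e" using e by (intro mult_right_mono) auto
    also have "\<dots> = d" unfolding e_def by (metis add_nonneg_pos less_irrefl nonzero_mult_div_cancel_left norm_ge_zero times_divide_eq_right zero_less_one)
    finally show ?thesis .
  qed
  ultimately show "0 \<le> tr (S o\<^sub>L T) + d" by linarith
qed

lemma tr_compose_mono:
  assumes "S \<in> R" "positive_op S" "T \<in> R" "U \<in> R" "positive_op (U - T)"
  shows "tr (S o\<^sub>L T) \<le> tr (S o\<^sub>L U)"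
  using tr_compose_nonneg[of S "U - T"] assms
  by (simp add: blinfun_compose_simps tr_diff R_intros)

text \<open>The trace removes the obstruction to the chain rule, the failure of \<open>X\<close> and its derivative
  to commute; multiplying with a factor \<open>Y\<close> that commutes with \<open>X\<close> makes the induction work.\<close>

lemma op_poly_has_vector_derivative:
  assumes A: "A \<in> R" and B: "B \<in> R"
  defines "X \<equiv> \<lambda>s. A + s *\<^sub>R B"
  shows "\<exists>D\<in>R. ((\<lambda>s. op_poly p (X s)) has_vector_derivative D) (at s) \<and>
    (\<forall>Y\<in>R. Y o\<^sub>L X s = X s o\<^sub>L Y \<longrightarrow>
      tr (Y o\<^sub>L D) = tr (Y o\<^sub>L (op_poly (pderiv p) (X s) o\<^sub>L B)))"
proof (induction p)
  case 0
  have "0 \<in> R" using R_scaleR[OF A, of 0] by simp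
  then show ?case by (intro bexI[of _ 0]) auto
next
  case (pCons a p)
  then obtain D where D: "D \<in> R" "((\<lambda>s. op_poly p (X s)) has_vector_derivative D) (at s)"
    and trD: "\<And>Y. Y \<in> R \<Longrightarrow> Y o\<^sub>L X s = X s o\<^sub>L Y \<Longrightarrow>
      tr (Y o\<^sub>L D) = tr (Y o\<^sub>L (op_poly (pderiv p) (X s) o\<^sub>L B))"
    by blast
  have XR: "X s \<in> R" unfolding X_def by (intro R_intros A B)
  let ?P = "op_poly p (X s)" and ?P' = "op_poly (pderiv p) (X s)"
  let ?D = "(X s o\<^sub>L D) + (B o\<^sub>L ?P)"
  have PR: "?P \<in> R" "?P' \<in> R" by (intro R_op_poly XR)+
  have "(X has_vector_derivative B) (at s)"
    unfolding X_def by (auto intro!: derivative_eq_intros)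
  then have "((\<lambda>s. op_poly (pCons a p) (X s)) has_vector_derivative ?D) (at s)"
    using bounded_bilinear.has_vector_derivative[OF bounded_bilinear_blinfun_compose _ D(2)]
    by (auto intro!: derivative_eq_intros)
  moreover have "tr (Y o\<^sub>L ?D) = tr (Y o\<^sub>L (op_poly (pderiv (pCons a p)) (X s) o\<^sub>L B))"
    if Y: "Y \<in> R" "Y o\<^sub>L X s = X s o\<^sub>L Y" for Y
  proof -
    \<comment> \<open>\<open>Y o\<^sub>L X s\<close> again commutes with \<open>X s\<close>, so the
      induction hypothesis applies to it and absorbs the extra factor \<open>X s\<close> of the
      product rule.\<close>
    have "(Y o\<^sub>L X s) o\<^sub>L X s = X s o\<^sub>L (Y o\<^sub>L X s)"
      by (simp add: Y blinfun_compose_assoc)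
    from trD[OF R_compose[OF Y(1) XR] this]
    have "tr (Y o\<^sub>L (X s o\<^sub>L D)) = tr (Y o\<^sub>L (X s o\<^sub>L (?P' o\<^sub>L B)))"
      by (simp only: blinfun_compose_assoc)
    moreover have "tr (Y o\<^sub>L (B o\<^sub>L ?P)) = tr (Y o\<^sub>L (?P o\<^sub>L B))"
    proof -
      have "tr (Y o\<^sub>L (B o\<^sub>L ?P)) = tr (?P o\<^sub>L (Y o\<^sub>L B))"
        using tr_commute[of "Y o\<^sub>L B" ?P] Y B PR by (simp add: R_intros blinfun_compose_assoc)
      also have "?P o\<^sub>L (Y o\<^sub>L B) = Y o\<^sub>L (?P o\<^sub>L B)"
        using op_poly_commute[OF Y(2), of p] by (metis blinfun_compose_assoc)
      finally show ?thesis .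
    qed
    ultimately show ?thesis
      using Y B XR PR D(1)
      by (simp add: pderiv_pCons op_poly_add blinfun_compose_simps tr_add R_intros
          blinfun_compose_assoc)
  qed
  moreover have "?D \<in> R" by (intro R_intros XR D PR B)
  ultimately show ?case by blast
qed

text \<open>The preceding lemma at \<open>Y = id_blinfun\<close>, plus continuity of the trace.
  Since \<open>abs_tr_le\<close> concerns symmetric operators, the passage to the limit uses
  difference quotients, which are symmetric and have a symmetric limit.\<close>

lemma tr_op_poly_has_derivative:
  assumes A: "A \<in> R" "symmetric_op A" and B: "B \<in> R" "symmetric_op B"
  shows "((\<lambda>s. tr (op_poly p (A + s *\<^sub>R B))) has_real_derivative
    tr (op_poly (pderiv p) (A + s *\<^sub>R B) o\<^sub>L B)) (at s)"
proof -
  define X where "X = (\<lambda>s. A + s *\<^sub>R B)"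
  define F where "F = (\<lambda>s. op_poly p (X s))"
  have XR: "X s \<in> R" and Xsym: "symmetric_op (X s)" for s
    unfolding X_def by (intro R_intros A B symmetric_op_add symmetric_op_scaleR)+
  have FR: "F s \<in> R" and Fsym: "symmetric_op (F s)" for s
    unfolding F_def by (intro R_op_poly XR symmetric_op_poly Xsym)+
  obtain D where D: "D \<in> R" "(F has_vector_derivative D) (at s)"
    and trD: "\<And>Y. Y \<in> R \<Longrightarrow> Y o\<^sub>L X s = X s o\<^sub>L Y \<Longrightarrow>
      tr (Y o\<^sub>L D) = tr (Y o\<^sub>L (op_poly (pderiv p) (X s) o\<^sub>L B))"
    using op_poly_has_vector_derivative[OF A(1) B(1), of p s] unfolding F_def X_def by blast
  define Q where "Q = (\<lambda>h. inverse h *\<^sub>R (F (s + h) - F s))"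
  have lim0: "((\<lambda>h. norm (F (s + h) - F s - h *\<^sub>R D) / norm h) \<longlongrightarrow> 0) (at 0)"
    using D(2) by (simp add: has_vector_derivative_def has_derivative_at)
  have quot: "norm (Q h - D) = norm (F (s + h) - F s - h *\<^sub>R D) / norm h" if "h \<noteq> 0" for h
  proof -
    have "Q h - D = inverse h *\<^sub>R (F (s + h) - F s - h *\<^sub>R D)"
      using that by (simp add: Q_def algebra_simps)
    then show ?thesis by (simp add: divide_inverse mult.commute)
  qed
  have lim: "((\<lambda>h. norm (Q h - D)) \<longlongrightarrow> 0) (at 0)"
    by (rule Lim_transform_eventually[OF lim0]) (simp add: eventually_at_filter quot)
  have QR: "Q h \<in> R" and Qsym: "symmetric_op (Q h)" for h
    unfolding Q_def by (intro R_intros FR symmetric_op_scaleR symmetric_op_diff Fsym)+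
  have "(Q \<longlongrightarrow> D) (at 0)"
    using lim by (simp add: tendsto_norm_zero_iff LIM_zero_iff)
  then have Dsym: "symmetric_op D"
    by (rule symmetric_op_limit) (simp_all add: Qsym)
  have "((\<lambda>h. tr (Q h) - tr D) \<longlongrightarrow> 0) (at 0)"
  proof (rule Lim_null_comparison[OF _ lim])
    show "\<forall>\<^sub>F h in at 0. norm (tr (Q h) - tr D) \<le> norm (Q h - D)"
      using abs_tr_le[OF R_diff[OF QR D(1)] symmetric_op_diff[OF Qsym Dsym]]
      by (simp add: tr_diff QR D)
  qed
  then have "((\<lambda>h. tr (Q h)) \<longlongrightarrow> tr D) (at 0)" by (simp add: LIM_zero_iff)
  moreover have "tr (Q h) = (tr (F (s + h)) - tr (F s)) / h" for h
    by (simp add: Q_def tr_scaleR tr_diff R_intros FR divide_inverse mult.commute)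
  ultimately have "((\<lambda>s. tr (F s)) has_real_derivative tr D) (at s)"
    by (simp add: DERIV_def)
  moreover have "tr D = tr (op_poly (pderiv p) (X s) o\<^sub>L B)"
    using trD[OF R_id] by simp
  ultimately show ?thesis by (simp add: F_def X_def)
qed

end

section \<open>The logarithm and the inverse\<close>

text \<open>A uniform approximation of \<open>ln\<close> says nothing about derivatives. So
  \<open>inverse\<close> is approximated and integrated, and the mean value bound controls the
  distance to \<open>ln\<close>.\<close>

lemma poly_approx_ln:
  fixes a b e :: real
  assumes "0 < a" "a \<le> b" "e > 0"
  obtains p where "\<And>t. t \<in> {a..b} \<Longrightarrow> \<bar>poly (pderiv p) t - inverse t\<bar> \<le> e"
    and "\<And>t. t \<in> {a..b} \<Longrightarrow> \<bar>poly p t - ln t\<bar> \<le> e"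
proof -
  \<comment> \<open>Serves both errors: \<open>d\<close> itself for the derivative and
    \<open>d * b\<close> after integration over an interval of length at most
    \<open>b\<close>.\<close>
  define d where "d = e / (1 + b)"
  have b: "1 + b > 0" "b \<ge> 0" using assms by linarith+
  then have d: "d > 0" "d \<le> e" "d * b \<le> e"
    using assms by (simp_all add: d_def divide_le_eq distrib_left)
  have "continuous_on {a..b} inverse" using assms by (intro continuous_intros) auto
  then obtain q where q: "\<And>t. t \<in> {a..b} \<Longrightarrow> \<bar>poly q t - inverse t\<bar> < d"
    using Weierstrass_poly[OF _ d(1)] by blast
  obtain r where r: "pderiv r = q" using ex_pderiv by blast
  \<comment> \<open>The constant is chosen so that \<open>p\<close> agrees with \<open>ln\<close> at
    \<open>a\<close>.\<close>
  define p where "p = r + [:ln a - poly r a:]"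
  have p: "pderiv p = q" by (simp add: p_def pderiv_add r)
  have "\<bar>poly p t - ln t\<bar> \<le> e" if t: "t \<in> {a..b}" for t
  proof -
    have "norm ((poly p t - ln t) - (poly p a - ln a)) \<le> d * norm (t - a)"
    proof (rule field_differentiable_bound[where S = "{a..b}" and f' = "\<lambda>t. poly q t - inverse t"])
      fix s assume s: "s \<in> {a..b}"
      then show "((\<lambda>t. poly p t - ln t) has_field_derivative poly q s - inverse s) (at s within {a..b})"
        using assms by (auto intro!: derivative_eq_intros DERIV_subset[OF poly_DERIV]
              simp: p inverse_eq_divide)
      show "norm (poly q s - inverse s) \<le> d" using q[OF s] by simp
    qed (use t assms in auto)
    also have "\<dots> \<le> d * b" using t assms d by (intro mult_left_mono) auto
    finally show ?thesis using d by (simp add: p_def)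
  qed
  moreover have "\<bar>poly (pderiv p) t - inverse t\<bar> \<le> e" if "t \<in> {a..b}" for t
    using q[OF that] d p by simp
  ultimately show thesis using that by blast
qed

text \<open>If \<open>q\<close> is close to \<open>inverse\<close>, then \<open>t * poly q t\<close>
  is close to \<open>1\<close> on \<open>{a..b}\<close>, so \<open>T o\<^sub>L q(T)\<close> is close
  to the identity. The other order follows because polynomials in \<open>T\<close> commute with
  \<open>T\<close>.\<close>

lemma (in symmetric_op_on) functional_calculus_inverse:
  assumes a: "0 < a" "a \<le> b"
  shows "T o\<^sub>L functional_calculus inverse T = id_blinfun"
    and "functional_calculus inverse T o\<^sub>L T = id_blinfun"
proof -
  let ?J = "functional_calculus inverse T"
  have cont: "continuous_on {a..b} inverse" using a by (intro continuous_intros) auto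
  show *: "T o\<^sub>L ?J = id_blinfun"
  proof -
    have "norm (id_blinfun - (T o\<^sub>L ?J)) \<le> 0 + e" if e: "e > 0" for e
    proof -
      \<comment> \<open>\<open>b * d\<close> pays for comparing \<open>t * poly q t\<close> with
        \<open>1\<close>, and \<open>norm T * d\<close> for replacing \<open>q(T)\<close> by
        \<open>?J\<close>.\<close>
      define d where "d = e / (b + norm T)"
      have bT: "b + norm T > 0" using a by (simp add: add_pos_nonneg)
      have d: "d > 0" "d * (b + norm T) = e" using bT e by (auto simp: d_def)
      obtain q where q: "\<And>t. t \<in> {a..b} \<Longrightarrow> \<bar>poly q t - inverse t\<bar> < d"
        using Weierstrass_poly[OF cont d(1)] by blast
      have "norm (op_poly q T - ?J) \<le> d"
        using q d by (intro norm_op_poly_functional_calculus_le cont) (auto intro: less_imp_le)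
      then have 1: "norm (T o\<^sub>L (op_poly q T - ?J)) \<le> norm T * d"
        by (meson mult_left_mono norm_blinfun_compose norm_ge_zero order_trans)
      have "norm (op_poly [:1:] T - op_poly (pCons 0 q) T) \<le> b * d"
      proof (rule norm_op_poly_diff_le)
        fix t assume "t \<in> real_spectrum T"
        then have t: "t \<in> {a..b}" using spectrum by blast
        have "poly [:1:] t - poly (pCons 0 q) t = - (t * (poly q t - inverse t))"
          using t a by (simp add: algebra_simps)
        then have "\<bar>poly [:1:] t - poly (pCons 0 q) t\<bar> = \<bar>t\<bar> * \<bar>poly q t - inverse t\<bar>"
          by (simp add: abs_mult)
        also have "\<dots> \<le> b * d" using q[OF t] t a by (intro mult_mono) auto
        finally show "\<bar>poly [:1:] t - poly (pCons 0 q) t\<bar> \<le> b * d" .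
      qed (use d a in simp)
      then have "norm (id_blinfun - (T o\<^sub>L op_poly q T)) \<le> b * d" by simp
      moreover have "norm (id_blinfun - (T o\<^sub>L ?J))
          \<le> norm (id_blinfun - (T o\<^sub>L op_poly q T)) + norm (T o\<^sub>L (op_poly q T - ?J))"
        using norm_triangle_ineq[of "id_blinfun - (T o\<^sub>L op_poly q T)" "T o\<^sub>L (op_poly q T - ?J)"]
        by (simp add: blinfun_compose_simps)
      ultimately have "norm (id_blinfun - (T o\<^sub>L ?J)) \<le> b * d + norm T * d"
        using 1 by linarith
      then show ?thesis using d(2) by (simp add: algebra_simps)
    qed
    then have "norm (id_blinfun - (T o\<^sub>L ?J)) \<le> 0" by (rule field_le_epsilon)
    then show ?thesis by simp
  qed
  obtain p where p: "(\<lambda>n. op_poly (p n) T) \<longlonglongrightarrow> ?J"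
    using functional_calculus_op_poly_seq[OF cont] .
  have "(\<lambda>n. T o\<^sub>L op_poly (p n) T) \<longlonglongrightarrow> (T o\<^sub>L ?J)"
    by (rule bounded_bilinear.tendsto[OF bounded_bilinear_blinfun_compose tendsto_const p])
  moreover have "(\<lambda>n. op_poly (p n) T o\<^sub>L T) \<longlonglongrightarrow> (?J o\<^sub>L T)"
    by (rule bounded_bilinear.tendsto[OF bounded_bilinear_blinfun_compose p tendsto_const])
  moreover have "op_poly q T o\<^sub>L T = T o\<^sub>L op_poly q T" for q
    by (rule op_poly_commute[symmetric]) simp
  ultimately show "?J o\<^sub>L T = id_blinfun"
    using * LIMSEQ_unique by auto
qed

lemma positive_op_diff_scaleR_iff:
  assumes "symmetric_op T"
  shows "positive_op (T - c *\<^sub>R id_blinfun) \<longleftrightarrow> (\<forall>x. c * (norm x)\<^sup>2 \<le> T x \<bullet> x)"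
proof -
  have "symmetric_op (T - c *\<^sub>R id_blinfun)"
    by (intro symmetric_op_diff symmetric_op_scaleR symmetric_op_id assms)
  then show ?thesis
    by (simp add: positive_op_iff blinfun.bilinear_simps inner_diff_left power2_norm_eq_inner)
qed

text \<open>Apply \<open>positive_op_norm_le_inner\<close> to \<open>X\<close> at the vector
  \<open>J x\<close>, which \<open>X\<close> sends to \<open>x\<close>.\<close>

lemma positive_op_inverse_bounded_below:
  fixes X J :: "'a::separable_hilbert_space \<Rightarrow>\<^sub>L 'a"
  assumes X: "positive_op X" "norm X \<le> M" "M > 0" and J: "symmetric_op J" "X o\<^sub>L J = id_blinfun"
  shows "positive_op (J - (1 / M) *\<^sub>R id_blinfun)"
  unfolding positive_op_diff_scaleR_iff[OF J(1)]
proof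
  fix x :: 'a
  have XJ: "X (J x) = x" using J(2) by (metis blinfun_apply_blinfun_compose blinfun_apply_id_blinfun id_apply)
  have "(norm (X (J x)))\<^sup>2 \<le> norm X * (X (J x) \<bullet> J x)"
    by (rule positive_op_norm_le_inner[OF X(1)])
  also have "\<dots> \<le> M * (X (J x) \<bullet> J x)"
    by (intro mult_right_mono X positive_opD)
  finally have "(norm x)\<^sup>2 \<le> M * (x \<bullet> J x)" by (simp add: XJ)
  then show "(1 / M) * (norm x)\<^sup>2 \<le> J x \<bullet> x"
    using X(3) by (simp add: inner_commute field_simps)
qed

lemma positive_op_square: "symmetric_op D \<Longrightarrow> positive_op (D o\<^sub>L D)"
  by (auto simp: positive_op_iff symmetric_opD[of D "D _"] intro: symmetric_op_compose)

context tracial_von_neumann_algebra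
begin

lemma R_functional_calculus:
  assumes "symmetric_op_on T a b" "T \<in> R" "continuous_on {a..b} f"
  shows "functional_calculus f T \<in> R"
proof -
  obtain p where "(\<lambda>n. op_poly (p n) T) \<longlonglongrightarrow> functional_calculus f T"
    using symmetric_op_on.functional_calculus_op_poly_seq[OF assms(1,3)] .
  then show ?thesis by (rule R_limit) (rule R_op_poly[OF assms(2)])
qed

lemma abs_tr_op_poly_functional_calculus_le:
  assumes T: "symmetric_op_on T a b" "T \<in> R" and f: "continuous_on {a..b} f" and "e \<ge> 0"
    and "\<And>t. t \<in> {a..b} \<Longrightarrow> \<bar>poly p t - f t\<bar> \<le> e" and B: "B \<in> R" "symmetric_op B"
  shows "\<bar>tr (op_poly p T o\<^sub>L B) - tr (functional_calculus f T o\<^sub>L B)\<bar> \<le> e * norm B"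
proof -
  interpret symmetric_op_on T a b by fact
  let ?E = "op_poly p T - functional_calculus f T"
  have in_R: "op_poly p T \<in> R" "functional_calculus f T \<in> R"
    using R_op_poly R_functional_calculus assms by blast+
  have "\<bar>tr (?E o\<^sub>L B)\<bar> \<le> norm ?E * norm B"
    by (intro abs_tr_compose_le B R_intros in_R symmetric_op_diff symmetric_op_poly symmetric
        symmetric_op_functional_calculus f)
  also have "\<dots> \<le> e * norm B"
    by (intro mult_right_mono norm_op_poly_functional_calculus_le assms) auto
  finally show ?thesis using in_R B by (simp add: blinfun_compose_simps tr_diff R_intros)
qed

definition tr_log :: "('a \<Rightarrow>\<^sub>L 'a) \<Rightarrow> real"
  where "tr_log T = tr (op_log (op_abs T))"

lemma fuglede_kadison_det_eq: "fuglede_kadison_det \<tau> T = exp (tr_log T)"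
  by (simp add: fuglede_kadison_det_def tr_log_def tr_def)

text \<open>The estimate \<open>abs_tr_op_poly_functional_calculus_le\<close> at
  \<open>B = id_blinfun\<close>; positivity of \<open>T\<close> removes
  \<open>op_abs\<close>.\<close>

lemma abs_tr_op_poly_tr_log_le:
  assumes T: "symmetric_op_on T a b" "T \<in> R" "positive_op T" and "0 < a" and "e \<ge> 0"
    and "\<And>t. t \<in> {a..b} \<Longrightarrow> \<bar>poly p t - ln t\<bar> \<le> e"
  shows "\<bar>tr (op_poly p T) - tr_log T\<bar> \<le> e"
proof -
  have "continuous_on {a..b} ln" using assms(4) by (intro continuous_intros) auto
  from abs_tr_op_poly_functional_calculus_le[OF T(1,2) this assms(5,6) R_id symmetric_op_id]
  have "\<bar>tr (op_poly p T) - tr_log T\<bar> \<le> e * norm (id_blinfun :: 'a \<Rightarrow>\<^sub>L 'a)"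
    by (simp add: tr_log_def op_log_def op_abs_positive T)
  also have "\<dots> \<le> e" using norm_blinfun_id_le assms(5) by (metis mult_left_le)
  finally show ?thesis .
qed

end

section \<open>The expectation and the inverse\<close>

locale trace_preserving_expectation = tracial_von_neumann_algebra R \<tau>
  for R :: "('a::separable_hilbert_space \<Rightarrow>\<^sub>L 'a) set" and \<tau> +
  fixes S :: "('a \<Rightarrow>\<^sub>L 'a) set" and \<Phi> :: "('a \<Rightarrow>\<^sub>L 'a) \<Rightarrow> 'a \<Rightarrow>\<^sub>L 'a"
  assumes S_algebra: "von_neumann_algebra S" and S_subset: "S \<subseteq> R"
    and expectation: "conditional_expectation R S \<Phi>"
    and preserving: "\<And>T. T \<in> R \<Longrightarrow> \<tau> (\<Phi> T) = \<tau> T"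
begin

lemma S_id: "id_blinfun \<in> S"
  using S_algebra by (simp add: von_neumann_algebra_def)

lemma \<Phi>_in_S: "T \<in> R \<Longrightarrow> \<Phi> T \<in> S"
  and \<Phi>_add: "T \<in> R \<Longrightarrow> U \<in> R \<Longrightarrow> \<Phi> (T + U) = \<Phi> T + \<Phi> U"
  and \<Phi>_positive: "T \<in> R \<Longrightarrow> positive_op T \<Longrightarrow> positive_op (\<Phi> T)"
  and \<Phi>_id: "\<Phi> id_blinfun = id_blinfun"
  and \<Phi>_module: "T \<in> R \<Longrightarrow> U \<in> S \<Longrightarrow> V \<in> S \<Longrightarrow> \<Phi> (U o\<^sub>L T o\<^sub>L V) = U o\<^sub>L \<Phi> T o\<^sub>L V"
  using expectation by (auto simp: conditional_expectation_def)

lemma \<Phi>_scaleR: "T \<in> R \<Longrightarrow> \<Phi> (r *\<^sub>R T) = r *\<^sub>R \<Phi> T"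
  using expectation by (simp add: conditional_expectation_def op_scaleC_of_real[symmetric])

lemma \<Phi>_diff: "T \<in> R \<Longrightarrow> U \<in> R \<Longrightarrow> \<Phi> (T - U) = \<Phi> T - \<Phi> U"
  using \<Phi>_add[of "T - U" U] R_diff[of T U] by (metis add_diff_cancel diff_add_cancel)

lemma \<Phi>_fixed: "T \<in> S \<Longrightarrow> \<Phi> T = T"
  using \<Phi>_module[OF R_id, of T id_blinfun] by (simp add: S_id \<Phi>_id)

lemma tr_\<Phi>: "T \<in> R \<Longrightarrow> tr (\<Phi> T) = tr T"
  by (simp add: tr_def preserving)

text \<open>With \<open>Y = \<Phi> X\<close> and \<open>D = X - Y\<close>, expanding gives
  \<open>\<Phi> (D X\<^sup>-\<^sup>1 D) = Y (\<Phi> (X\<^sup>-\<^sup>1) - Y\<^sup>-\<^sup>1) Y\<close>, so that \<open>\<Phi> (X\<^sup>-\<^sup>1) - Y\<^sup>-\<^sup>1\<close> is positive and controls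
  \<open>D\<close>.\<close>

lemma tr_inverse_compose_ge:
  assumes X: "X \<in> R" "positive_op X" "norm X \<le> M"
    and J: "J \<in> R" "symmetric_op J" "J o\<^sub>L X = id_blinfun" "X o\<^sub>L J = id_blinfun"
    and K: "K \<in> R" "symmetric_op K" "K o\<^sub>L \<Phi> X = id_blinfun" "\<Phi> X o\<^sub>L K = id_blinfun"
    and M: "norm (\<Phi> X) \<le> M" "M > 0"
    and B: "B \<in> S" "positive_op (B - b *\<^sub>R id_blinfun)" "b \<ge> 0"
  shows "b * tr ((X - \<Phi> X) o\<^sub>L (X - \<Phi> X)) / M ^ 3 \<le> tr (J o\<^sub>L B) - tr (K o\<^sub>L B)"
proof -
  define Y D Z where "Y = \<Phi> X" and "D = X - Y" and "Z = \<Phi> J - K"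
  have Y: "Y \<in> S" "Y \<in> R" "positive_op Y"
    using X \<Phi>_in_S S_subset \<Phi>_positive by (auto simp: Y_def)
  have symX: "symmetric_op X" and symY: "symmetric_op Y"
    using X Y by (auto intro: positive_op_symmetric)
  have D: "D \<in> R" "symmetric_op D"
    unfolding D_def by (intro R_intros symmetric_op_diff X Y symX symY)+
  have BR: "B \<in> R" using B S_subset by blast
  have JR: "\<Phi> J \<in> R" using J \<Phi>_in_S S_subset by blast
  have ZR: "Z \<in> R" unfolding Z_def by (intro R_intros JR K)
  have K': "K o\<^sub>L Y = id_blinfun" "Y o\<^sub>L K = id_blinfun" using K by (simp_all add: Y_def)
  have J_below: "positive_op (J - (1 / M) *\<^sub>R id_blinfun)"
    by (rule positive_op_inverse_bounded_below[OF X(2,3) M(2) J(2,4)])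
  have posJ: "positive_op J"
    unfolding positive_op_iff
  proof (intro conjI allI J(2))
    fix x :: 'a
    have "(1 / M) * (norm x)\<^sup>2 \<ge> 0" using M by simp
    also have "(1 / M) * (norm x)\<^sup>2 \<le> J x \<bullet> x"
      using J_below unfolding positive_op_diff_scaleR_iff[OF J(2)] by blast
    finally show "J x \<bullet> x \<ge> 0" .
  qed
  have "X o\<^sub>L (J o\<^sub>L T) = T" for T
    by (metis J(4) blinfun_compose_assoc blinfun_compose_id(2))
  \<comment> \<open>Grouped for the expectation, which sends \<open>X - Y\<close> to
    \<open>0\<close> and the rest to \<open>(Y o\<^sub>L \<Phi> J o\<^sub>L Y) - Y\<close>.\<close>
  then have DJD: "D o\<^sub>L J o\<^sub>L D = (X - Y) - (Y - (Y o\<^sub>L J o\<^sub>L Y))"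
    by (simp add: D_def blinfun_compose_simps blinfun_compose_assoc J)
  have "\<Phi> (D o\<^sub>L J o\<^sub>L D) = (Y o\<^sub>L \<Phi> J o\<^sub>L Y) - Y"
    unfolding DJD using X(1) Y J(1)
    by (simp add: \<Phi>_diff R_intros \<Phi>_module \<Phi>_fixed Y_def[symmetric])
  also have "\<dots> = Y o\<^sub>L Z o\<^sub>L Y"
    by (simp add: Z_def blinfun_compose_simps K')
  finally have W: "\<Phi> (D o\<^sub>L J o\<^sub>L D) = Y o\<^sub>L Z o\<^sub>L Y" .
  have "positive_op (Y o\<^sub>L Z o\<^sub>L Y)"
    unfolding W[symmetric] by (intro \<Phi>_positive R_intros D J positive_op_sandwich posJ)
  \<comment> \<open>Conjugation by \<open>K\<close>, the inverse of \<open>Y\<close>, strips the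
    outer factors.\<close>
  then have "positive_op (K o\<^sub>L (Y o\<^sub>L Z o\<^sub>L Y) o\<^sub>L K)"
    by (rule positive_op_sandwich[OF _ K(2)])
  moreover have "K o\<^sub>L (Y o\<^sub>L Z o\<^sub>L Y) o\<^sub>L K = Z"
  proof -
    have "K o\<^sub>L (Y o\<^sub>L Z o\<^sub>L Y) o\<^sub>L K = (K o\<^sub>L Y) o\<^sub>L Z o\<^sub>L (Y o\<^sub>L K)"
      by (simp only: blinfun_compose_assoc)
    then show ?thesis by (simp add: K')
  qed
  ultimately have posZ: "positive_op Z" by simp
  have "\<Phi> (J o\<^sub>L B) = \<Phi> J o\<^sub>L B"
    using \<Phi>_module[OF J(1) S_id B(1)] by simp
  then have "tr (J o\<^sub>L B) - tr (K o\<^sub>L B) = tr (Z o\<^sub>L B)"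
    using tr_\<Phi>[of "J o\<^sub>L B"] J(1) JR K(1) BR
    by (simp add: Z_def blinfun_compose_simps tr_diff R_intros)
  moreover have "tr (Z o\<^sub>L (b *\<^sub>R id_blinfun)) \<le> tr (Z o\<^sub>L B)"
    by (intro tr_compose_mono ZR posZ R_intros BR B)
  ultimately have 1: "b * tr Z \<le> tr (J o\<^sub>L B) - tr (K o\<^sub>L B)"
    by (simp add: blinfun_compose_simps tr_scaleR ZR)
  \<comment> \<open>The bound \<open>M * M\<close> on \<open>Y\<^sup>2\<close> contributes two of
    the three factors \<open>M\<close>; the third comes from \<open>J_below\<close>.\<close>
  have "norm (Y o\<^sub>L Y) \<le> M * M"
    using M(1) norm_blinfun_compose[of Y Y] by (fold Y_def) (meson mult_mono' norm_ge_zero order_trans)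
  then have "positive_op ((M * M) *\<^sub>R id_blinfun - (Y o\<^sub>L Y))"
    by (intro positive_op_norm_minus symmetric_op_compose symY refl)
  then have "tr (Z o\<^sub>L (Y o\<^sub>L Y)) \<le> tr (Z o\<^sub>L ((M * M) *\<^sub>R id_blinfun))"
    by (intro tr_compose_mono ZR posZ R_intros Y)
  moreover have "tr (Y o\<^sub>L Z o\<^sub>L Y) = tr (Z o\<^sub>L (Y o\<^sub>L Y))"
    using tr_commute[of Y "Z o\<^sub>L Y"] Y ZR by (simp add: blinfun_compose_assoc R_intros)
  moreover have "tr (D o\<^sub>L J o\<^sub>L D) = tr (Y o\<^sub>L Z o\<^sub>L Y)"
    using tr_\<Phi>[of "D o\<^sub>L J o\<^sub>L D"] D J(1) by (simp add: W R_intros)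
  ultimately have 2: "tr (D o\<^sub>L J o\<^sub>L D) \<le> M * M * tr Z"
    by (simp add: blinfun_compose_simps tr_scaleR ZR)
  have "tr ((D o\<^sub>L D) o\<^sub>L ((1 / M) *\<^sub>R id_blinfun)) \<le> tr ((D o\<^sub>L D) o\<^sub>L J)"
    by (intro tr_compose_mono R_intros D J positive_op_square J_below)
  moreover have "tr ((D o\<^sub>L D) o\<^sub>L J) = tr (D o\<^sub>L J o\<^sub>L D)"
    using tr_commute[of D "D o\<^sub>L J"] D J(1) by (simp add: blinfun_compose_assoc R_intros)
  ultimately have "tr (D o\<^sub>L D) / M \<le> tr (D o\<^sub>L J o\<^sub>L D)"
    by (simp add: blinfun_compose_simps tr_scaleR D R_intros)
  with 2 have "tr (D o\<^sub>L D) / M \<le> M * M * tr Z" by linarith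
  then have "tr (D o\<^sub>L D) / M ^ 3 \<le> tr Z"
    using M(2) by (simp add: divide_le_eq power3_eq_cube algebra_simps)
  then have "b * (tr (D o\<^sub>L D) / M ^ 3) \<le> b * tr Z" using B(3) by (rule mult_left_mono)
  with 1 show ?thesis by (simp add: D_def Y_def)
qed

text \<open>A positive unital map preserves lower bounds by multiples of the identity. Thus
  \<open>A\<close> and \<open>\<Phi> A\<close> share the left end \<open>a\<close> of the spectral
  interval.\<close>

lemma \<Phi>_bounded_below:
  assumes A: "A \<in> R" "positive_op A" "\<And>x. A x \<bullet> x \<ge> a * (norm x)\<^sup>2"
  shows "\<Phi> A x \<bullet> x \<ge> a * (norm x)\<^sup>2"
proof -
  have "positive_op (A - a *\<^sub>R id_blinfun)"
    using A(3) by (simp add: positive_op_diff_scaleR_iff positive_op_symmetric A(2))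
  then have "positive_op (\<Phi> (A - a *\<^sub>R id_blinfun))"
    by (intro \<Phi>_positive R_intros A)
  then have "positive_op (\<Phi> A - a *\<^sub>R id_blinfun)"
    using A by (simp add: \<Phi>_diff \<Phi>_scaleR R_intros \<Phi>_id)
  then show ?thesis
    using A(1,2) by (simp add: positive_op_diff_scaleR_iff positive_op_symmetric \<Phi>_positive)
qed

text \<open>The difference of the two logarithmic determinants is compared along \<open>s \<mapsto> A + s B\<close>, with
  polynomials approximating \<open>ln\<close> together with its derivative.\<close>

lemma tr_log_expectation_ge:
  assumes A: "A \<in> R" "positive_op A" and a: "a > 0" "\<And>x. A x \<bullet> x \<ge> a * (norm x)\<^sup>2"
    and B: "B \<in> S" "positive_op B" and b: "positive_op (B - b *\<^sub>R id_blinfun)" "b \<ge> 0"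
    and M: "norm A + norm (\<Phi> A) + norm B + a \<le> M"
  shows "b * tr ((A - \<Phi> A) o\<^sub>L (A - \<Phi> A)) / M ^ 3
    \<le> (tr_log (A + B) - tr_log (\<Phi> A + B)) - (tr_log A - tr_log (\<Phi> A))" (is "?k \<le> ?rhs")
proof (rule field_le_epsilon)
  fix d :: real assume d: "d > 0"
  define C where "C = \<Phi> A"
  have C: "C \<in> R" "positive_op C" and C_below: "C x \<bullet> x \<ge> a * (norm x)\<^sup>2" for x
    using \<Phi>_in_S S_subset A \<Phi>_positive \<Phi>_bounded_below[OF A a(2)] by (auto simp: C_def)
  have BR: "B \<in> R" using B S_subset by blast
  have sym: "symmetric_op A" "symmetric_op C" "symmetric_op B"
    using A C B by (auto intro: positive_op_symmetric)
  have "a \<le> M" using M norm_ge_zero[of A] norm_ge_zero[of "\<Phi> A"] norm_ge_zero[of B] by linarith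
  with a(1) have M0: "M > 0" "a \<le> M" by simp_all
  \<comment> \<open>Stated for a general start \<open>A'\<close>, to be used with both
    \<open>A\<close> and \<open>\<Phi> A\<close>.\<close>
  have path: "A' + s *\<^sub>R B \<in> R \<and> positive_op (A' + s *\<^sub>R B) \<and> norm (A' + s *\<^sub>R B) \<le> M \<and>
      symmetric_op_on (A' + s *\<^sub>R B) a M"
    if A': "A' \<in> R" "positive_op A'" "\<And>x. A' x \<bullet> x \<ge> a * (norm x)\<^sup>2" "norm A' + norm B \<le> M"
      and s: "0 \<le> s" "s \<le> 1" for A' s
  proof -
    have symA': "symmetric_op (A' + s *\<^sub>R B)"
      by (intro symmetric_op_add symmetric_op_scaleR sym positive_op_symmetric A')
    have ge: "(A' + s *\<^sub>R B) x \<bullet> x \<ge> a * (norm x)\<^sup>2" for x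
      using A'(3)[of x] positive_opD[OF B(2), of x] s
      by (simp add: blinfun.bilinear_simps inner_add_left add_increasing2)
    have "(A' + s *\<^sub>R B) x \<bullet> x \<ge> 0" for x
      using ge[of x] a(1) by (smt (verit) mult_nonneg_nonneg zero_le_power2)
    moreover have "norm (A' + s *\<^sub>R B) \<le> M"
    proof -
      have "norm (A' + s *\<^sub>R B) \<le> norm A' + norm (s *\<^sub>R B)" by (rule norm_triangle_ineq)
      also have "norm (s *\<^sub>R B) \<le> norm B" using s by (simp add: mult_left_le_one_le)
      finally show ?thesis using A'(4) by simp
    qed
    ultimately show ?thesis
      using symA' real_spectrum_subset[OF symA' ge] A'(1) BR
      by (auto simp: positive_op_iff symmetric_op_on_def R_intros)
  qed
  have AB: "norm A + norm B \<le> M" "norm C + norm B \<le> M"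
    using M a(1) norm_ge_zero[of A] norm_ge_zero[of "\<Phi> A"] unfolding C_def by linarith+
  note pathA = path[OF A a(2) AB(1)] and pathC = path[OF C C_below AB(2)]
  \<comment> \<open>The error budget: \<open>2 * e * norm B\<close> for the two derivatives and
    \<open>4 * e\<close> for the four logarithmic traces.\<close>
  define e where "e = d / (4 + 2 * norm B)"
  have den: "4 + 2 * norm B > 0" by (simp add: add_pos_nonneg)
  have e: "e > 0" "e * (4 + 2 * norm B) = d" using d den by (auto simp: e_def)
  obtain p where p': "\<And>t. t \<in> {a..M} \<Longrightarrow> \<bar>poly (pderiv p) t - inverse t\<bar> \<le> e"
    and p: "\<And>t. t \<in> {a..M} \<Longrightarrow> \<bar>poly p t - ln t\<bar> \<le> e"
    using poly_approx_ln[OF a(1) M0(2) e(1)] by blast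
  define G where "G = (\<lambda>s. tr (op_poly p (A + s *\<^sub>R B)) - tr (op_poly p (C + s *\<^sub>R B)))"
  define G' where "G' = (\<lambda>s. tr (op_poly (pderiv p) (A + s *\<^sub>R B) o\<^sub>L B)
    - tr (op_poly (pderiv p) (C + s *\<^sub>R B) o\<^sub>L B))"
  have deriv: "(G has_real_derivative G' s) (at s)" for s
    unfolding G_def G'_def
    by (intro DERIV_diff tr_op_poly_has_derivative A C BR sym)
  have cont: "continuous_on {a..M} inverse" using a by (intro continuous_intros) auto
  have G'_ge: "G' s \<ge> ?k - 2 * e * norm B" if s: "0 \<le> s" "s \<le> 1" for s
  proof -
    define X Y where XY: "X = A + s *\<^sub>R B" "Y = C + s *\<^sub>R B"
    have X: "X \<in> R" "positive_op X" "norm X \<le> M" "symmetric_op_on X a M"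
      and Y: "Y \<in> R" "positive_op Y" "norm Y \<le> M" "symmetric_op_on Y a M"
      using pathA[OF s] pathC[OF s] by (simp_all add: XY)
    have \<Phi>X: "\<Phi> X = Y"
      using A BR B by (simp add: XY C_def \<Phi>_add \<Phi>_scaleR \<Phi>_fixed R_intros)
    let ?J = "functional_calculus inverse X" and ?K = "functional_calculus inverse Y"
    have "b * tr ((X - \<Phi> X) o\<^sub>L (X - \<Phi> X)) / M ^ 3 \<le> tr (?J o\<^sub>L B) - tr (?K o\<^sub>L B)"
      using X Y a M0 B b cont
      by (intro tr_inverse_compose_ge)
        (auto simp: \<Phi>X R_functional_calculus symmetric_op_on.symmetric_op_functional_calculus
          symmetric_op_on.functional_calculus_inverse)
    \<comment> \<open>The term \<open>s *\<^sub>R B\<close> is fixed by \<open>\<Phi>\<close> and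
      cancels in \<open>X - \<Phi> X\<close>, so the bound is the same for every
      \<open>s\<close>.\<close>
    then have "?k \<le> tr (?J o\<^sub>L B) - tr (?K o\<^sub>L B)"
      by (simp add: \<Phi>X) (simp add: XY C_def)
    moreover have "\<bar>tr (op_poly (pderiv p) X o\<^sub>L B) - tr (?J o\<^sub>L B)\<bar> \<le> e * norm B"
      using e p' by (intro abs_tr_op_poly_functional_calculus_le[OF X(4) X(1) cont] BR sym) auto
    moreover have "\<bar>tr (op_poly (pderiv p) Y o\<^sub>L B) - tr (?K o\<^sub>L B)\<bar> \<le> e * norm B"
      using e p' by (intro abs_tr_op_poly_functional_calculus_le[OF Y(4) Y(1) cont] BR sym) auto
    ultimately show ?thesis unfolding G'_def XY by linarith
  qed
  obtain s where s: "0 < s" "s < 1" "G 1 - G 0 = G' s"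
    using MVT2[of 0 1 G G'] deriv by auto
  then have "G 1 - G 0 \<ge> ?k - 2 * e * norm B" using G'_ge[of s] by simp
  moreover have near: "\<bar>tr (op_poly p A') - tr_log A'\<bar> \<le> e"
    if "A' \<in> R \<and> positive_op A' \<and> norm A' \<le> M \<and> symmetric_op_on A' a M" for A'
    using that e p a by (intro abs_tr_op_poly_tr_log_le[where a = a and b = M]) auto
  have "\<bar>tr (op_poly p (A + B)) - tr_log (A + B)\<bar> \<le> e" "\<bar>tr (op_poly p A) - tr_log A\<bar> \<le> e"
    "\<bar>tr (op_poly p (C + B)) - tr_log (C + B)\<bar> \<le> e" "\<bar>tr (op_poly p C) - tr_log C\<bar> \<le> e"
    using pathA[of 0] pathA[of 1] pathC[of 0] pathC[of 1] by (auto intro!: near)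
  ultimately have "?k - 2 * e * norm B - 4 * e \<le> ?rhs"
    unfolding G_def C_def by simp
  then show "?k \<le> ?rhs + d" using e(2) by (simp add: algebra_simps)
qed

end

section \<open>From logarithmic traces to determinants, and the equality case\<close>

theorem theorem4p11:
  fixes R S :: "('a::separable_hilbert_space \<Rightarrow>\<^sub>L 'a) set"
    and \<tau> :: "('a \<Rightarrow>\<^sub>L 'a) \<Rightarrow> complex"
    and \<Phi> :: "('a \<Rightarrow>\<^sub>L 'a) \<Rightarrow> 'a \<Rightarrow>\<^sub>L 'a"
    and A B :: "'a \<Rightarrow>\<^sub>L 'a"
  assumes "finite_von_neumann_algebra R"
    and "state_on R \<tau>" and "faithful_on R \<tau>" and "normal_on R \<tau>" and "tracial_on R \<tau>"
    and "von_neumann_algebra S" and "S \<subseteq> R"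
    and "conditional_expectation R S \<Phi>" and "\<Phi> ` R = S"
    and "\<forall>T\<in>R. \<tau> (\<Phi> T) = \<tau> T"
    and "A \<in> R" and "positive_op A" and "regular_op A"
    and "B \<in> S" and "positive_op B"
  shows "fuglede_kadison_det \<tau> (\<Phi> A + B) / fuglede_kadison_det \<tau> (\<Phi> A)
           \<le> fuglede_kadison_det \<tau> (A + B) / fuglede_kadison_det \<tau> A
    \<and> (regular_op B \<longrightarrow>
        (fuglede_kadison_det \<tau> (\<Phi> A + B) / fuglede_kadison_det \<tau> (\<Phi> A)
           = fuglede_kadison_det \<tau> (A + B) / fuglede_kadison_det \<tau> A
         \<longleftrightarrow> \<Phi> A = A))
    \<and> (\<Phi> A = A \<longleftrightarrow> A \<in> S)"
proof -
  interpret trace_preserving_expectation R \<tau> S \<Phi>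
    using assms by unfold_locales (auto simp: finite_von_neumann_algebra_def)
  obtain a where a: "a > 0" "\<And>x. A x \<bullet> x \<ge> a * (norm x)\<^sup>2"
    using positive_regular_bounded_below[OF \<open>positive_op A\<close> \<open>regular_op A\<close>] by metis
  define M where "M = norm A + norm (\<Phi> A) + norm B + a"
  have M: "M > 0" using a by (simp add: M_def add_nonneg_pos)
  let ?D = "A - \<Phi> A"
  let ?gap = "(tr_log (A + B) - tr_log (\<Phi> A + B)) - (tr_log A - tr_log (\<Phi> A))"
  have gap: "b * tr (?D o\<^sub>L ?D) / M ^ 3 \<le> ?gap" if "positive_op (B - b *\<^sub>R id_blinfun)" "b \<ge> 0" for b
    by (rule tr_log_expectation_ge) (use assms a that in \<open>auto simp: M_def\<close>)
  have ratio: "fuglede_kadison_det \<tau> T / fuglede_kadison_det \<tau> U = exp (tr_log T - tr_log U)" for T U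
    by (simp add: fuglede_kadison_det_eq exp_diff)
  \<comment> \<open>At \<open>b = 0\<close> the premise of \<open>gap\<close> is positivity of
    \<open>B\<close> and its lower bound is zero.\<close>
  have "?gap \<ge> 0" using gap[of 0] assms by simp
  moreover have "\<Phi> A = A" if "regular_op B" and gap0: "?gap = 0"
  proof -
    obtain b where b: "b > 0" "\<And>x. B x \<bullet> x \<ge> b * (norm x)\<^sup>2"
      using positive_regular_bounded_below[OF \<open>positive_op B\<close> \<open>regular_op B\<close>] by metis
    have "positive_op (B - b *\<^sub>R id_blinfun)"
      using b(2) assms by (simp add: positive_op_diff_scaleR_iff positive_op_symmetric)
    from gap[OF this] have le: "tr (?D o\<^sub>L ?D) \<le> 0"
      using gap0 b(1) M by (simp add: divide_le_0_iff mult_le_0_iff)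
    have "\<Phi> A \<in> R" using \<Phi>_in_S assms by blast
    then have DR: "?D o\<^sub>L ?D \<in> R" using assms by (intro R_intros)
    have symD: "symmetric_op ?D"
      using assms by (intro symmetric_op_diff positive_op_symmetric \<Phi>_positive)
    then have pos: "positive_op (?D o\<^sub>L ?D)" by (rule positive_op_square)
    \<comment> \<open>\<open>le\<close> bounds only the real part; positivity makes the value of
      \<open>\<tau>\<close> real and non-negative, hence zero.\<close>
    have "\<tau> (?D o\<^sub>L ?D) \<in> \<real>\<^sub>\<ge>\<^sub>0" using state DR pos by (simp add: state_on_def)
    then have "\<tau> (?D o\<^sub>L ?D) = 0"
      using le by (auto simp: tr_def complex_nonneg_Reals_iff complex_eq_iff)
    then have DD: "?D o\<^sub>L ?D = 0" using assms(3) DR pos by (simp add: faithful_on_def)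
    have "?D x = 0" for x
    proof -
      have "?D x \<bullet> ?D x = (?D o\<^sub>L ?D) x \<bullet> x" using symmetric_opD[OF symD, of "?D x" x] by simp
      then show ?thesis by (simp add: DD)
    qed
    then have "?D = 0" by (intro blinfun_eqI) simp
    then show ?thesis by simp
  qed
  moreover have "\<Phi> A = A \<longleftrightarrow> A \<in> S" using \<Phi>_fixed \<Phi>_in_S \<open>A \<in> R\<close> by metis
  \<comment> \<open>By \<open>ratio\<close> everything is a comparison of exponents. If
    \<open>\<Phi> A = A\<close>, both exponents coincide, which is the easy half of the equality
    case.\<close>
  ultimately show ?thesis unfolding ratio by auto
qed

end
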